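(* Let $\Omega\subseteq\Gamma$ be finite, contain $e$, and generate $\Gamma$ as a semigroup. Let $\mathcal Y=(Y_n)_{n\ge1}$ be a sequence of finite subsets of $\Gamma$ with $\bigcup_n Y_n=\Gamma$ and $Y_{n-1}\subseteq\mathrm{int}_\Omega Y_n\subseteq Y_n$ for all $n\ge2$. Then the sequence $(P_{\partial_\Omega Y_n})_{n\ge1}$ belongs to $\mathcal S_{\mathcal Y}({\sf BDO}(\Gamma))$, and $\mathcal J_{\mathcal Y}({\sf BDO}(\Gamma))$ is the smallest closed ideal of $\mathcal S_{\mathcal Y}({\sf BDO}(\Gamma))$ which contains $(P_{\partial_\Omega Y_n})_{n\ge1}$.
   Context: $\Gamma$ is a countable discrete group with identity $e$. For $X\subseteq\Gamma$, $P_X$ is the orthogonal projection of $l^2(\Gamma)$ onto $l^2(X)$ (functions supported in $X$). For $r\in\Gamma$, $(L_ru)(t)=u(r^{-1}t)$. ${\sf BDO}(\Gamma)$ is the smallest closed subalgebra of $L(l^2(\Gamma))$ containing all $L_r$ and all multiplication operators $aI$, $a\in l^\infty(\Gamma)$. For $A\subseteq\Gamma$: $\mathrm{int}_\Omega A:=\{a\in A:\ \omega a\in A \text{ for all }\omega\in\Omega\}$ and $\partial_\Omega A:=A\setminus\mathrm{int}_\Omega A$. $\mathcal F_{\mathcal Y}$ is the $C^*$-algebra of all bounded sequences $(A_n)$ of operators $A_n:\mathrm{im}\,P_{Y_n}\to\mathrm{im}\,P_{Y_n}$ with componentwise operations and supremum norm. $\mathcal S_{\mathcal Y}({\sf BDO}(\Gamma))$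 is the smallest closed $C^*$-subalgebra of $\mathcal F_{\mathcal Y}$ containing all $(P_{Y_n}AP_{Y_n})$ with $A\in{\sf BDO}(\Gamma)$; for its elements $W((A_n)):=\mathrm{s\text{-}lim}\,A_nP_{Y_n}$ exists, and $\mathcal J_{\mathcal Y}({\sf BDO}(\Gamma)):=\{(A_n)\in\mathcal S_{\mathcal Y}({\sf BDO}(\Gamma)):W((A_n))=0\}$. *)

theory Defs
  imports "HOL-Analysis.Analysis" "HOL-Library.Countable"
begin

text \<open>The group Gamma is a type of class group_add (written additively, not assumed
commutative): identity 0, product r + t, inverse - r.  Elements of l2(Gamma) are
functions Gamma to complex; operators are functions on such vectors, normalised
to vanish outside l2.\<close>

type_synonym 'g vec = "'g \<Rightarrow> complex"
type_synonym 'g op = "'g vec \<Rightarrow> 'g vec"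

definition l2 :: "'g vec set" where
  "l2 = {u. (\<lambda>t. (cmod (u t))^2) summable_on UNIV}"

definition l2norm :: "'g vec \<Rightarrow> real" where
  "l2norm u = sqrt (infsum (\<lambda>t. (cmod (u t))^2) UNIV)"

definition l2inner :: "'g vec \<Rightarrow> 'g vec \<Rightarrow> complex" where
  "l2inner u v = infsum (\<lambda>t. cnj (u t) * v t) UNIV"

definition zvec :: "'g vec" where "zvec = (\<lambda>_. 0)"

definition is_bop :: "'g op \<Rightarrow> bool" where
  "is_bop A \<longleftrightarrow> (\<forall>u\<in>l2. A u \<in> l2) \<and> (\<forall>u. u \<notin> l2 \<longrightarrow> A u = zvec)
     \<and> (\<forall>u\<in>l2. \<forall>v\<in>l2. A (\<lambda>t. u t + v t) = (\<lambda>t. A u t + A v t))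
     \<and> (\<forall>c. \<forall>u\<in>l2. A (\<lambda>t. c * u t) = (\<lambda>t. c * A u t))
     \<and> (\<exists>C. \<forall>u\<in>l2. l2norm (A u) \<le> C * l2norm u)"

definition opnorm :: "'g op \<Rightarrow> real" where
  "opnorm A = Sup {l2norm (A u) | u. u \<in> l2 \<and> l2norm u \<le> 1}"

definition op_add :: "'g op \<Rightarrow> 'g op \<Rightarrow> 'g op" where
  "op_add A B = (\<lambda>u t. A u t + B u t)"
definition op_diff :: "'g op \<Rightarrow> 'g op \<Rightarrow> 'g op" where
  "op_diff A B = (\<lambda>u t. A u t - B u t)"
definition op_smul :: "complex \<Rightarrow> 'g op \<Rightarrow> 'g op" where
  "op_smul c A = (\<lambda>u t. c * A u t)"

definition op_adj :: "'g op \<Rightarrow> 'g op" where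
  "op_adj A = (\<lambda>v. if v \<in> l2 then (THE w. w \<in> l2 \<and> (\<forall>u\<in>l2. l2inner (A u) v = l2inner u w))
                   else zvec)"

definition proj :: "'g set \<Rightarrow> 'g op" where
  "proj X = (\<lambda>u. if u \<in> l2 then (\<lambda>t. if t \<in> X then u t else 0) else zvec)"

definition shift :: "'g::group_add \<Rightarrow> 'g op" where
  "shift r = (\<lambda>u. if u \<in> l2 then (\<lambda>t. u (- r + t)) else zvec)"

definition mult_op :: "('g \<Rightarrow> complex) \<Rightarrow> 'g op" where
  "mult_op a = (\<lambda>u. if u \<in> l2 then (\<lambda>t. a t * u t) else zvec)"

definition op_closed :: "'g op set \<Rightarrow> bool" where
  "op_closed \<A> \<longleftrightarrow> (\<forall>X L. (\<forall>k. X k \<in> \<A>) \<longrightarrow> is_bop L \<longrightarrow>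
      (\<lambda>k. opnorm (op_diff (X k) L)) \<longlonglongrightarrow> 0 \<longrightarrow> L \<in> \<A>)"

definition BDO :: "'g::group_add op set" where
  "BDO = \<Inter>{\<A>. \<A> \<subseteq> {A. is_bop A}
      \<and> (\<forall>r. shift r \<in> \<A>)
      \<and> (\<forall>a. bdd_above (range (\<lambda>t. cmod (a t))) \<longrightarrow> mult_op a \<in> \<A>)
      \<and> (\<forall>A\<in>\<A>. \<forall>B\<in>\<A>. op_add A B \<in> \<A> \<and> A \<circ> B \<in> \<A>)
      \<and> (\<forall>c. \<forall>A\<in>\<A>. op_smul c A \<in> \<A>)
      \<and> op_closed \<A>}"

text \<open>Sequences of operators A_n on im P_{Y_n}, represented as operators on l2 with
A_n = P_{Y_n} A_n P_{Y_n} (indexing starts at 0).\<close>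
type_synonym 'g opseq = "nat \<Rightarrow> 'g op"

definition FY :: "(nat \<Rightarrow> 'g set) \<Rightarrow> 'g opseq set" where
  "FY Y = {A. (\<forall>n. is_bop (A n) \<and> A n = proj (Y n) \<circ> A n \<circ> proj (Y n))
             \<and> bdd_above (range (\<lambda>n. opnorm (A n)))}"

definition seq_dist :: "'g opseq \<Rightarrow> 'g opseq \<Rightarrow> real" where
  "seq_dist A B = Sup (range (\<lambda>n. opnorm (op_diff (A n) (B n))))"

definition seq_closed :: "(nat \<Rightarrow> 'g set) \<Rightarrow> 'g opseq set \<Rightarrow> bool" where
  "seq_closed Y \<A> \<longleftrightarrow> (\<forall>X L. (\<forall>k. X k \<in> \<A>) \<longrightarrow> L \<in> FY Y \<longrightarrow>
      (\<lambda>k. seq_dist (X k) L) \<longlonglongrightarrow> 0 \<longrightarrow> L \<in> \<A>)"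

definition seq_add :: "'g opseq \<Rightarrow> 'g opseq \<Rightarrow> 'g opseq" where
  "seq_add A B = (\<lambda>n. op_add (A n) (B n))"
definition seq_smul :: "complex \<Rightarrow> 'g opseq \<Rightarrow> 'g opseq" where
  "seq_smul c A = (\<lambda>n. op_smul c (A n))"
definition seq_mul :: "'g opseq \<Rightarrow> 'g opseq \<Rightarrow> 'g opseq" where
  "seq_mul A B = (\<lambda>n. A n \<circ> B n)"
definition seq_adj :: "'g opseq \<Rightarrow> 'g opseq" where
  "seq_adj A = (\<lambda>n. op_adj (A n))"

definition SY :: "(nat \<Rightarrow> 'g::group_add set) \<Rightarrow> 'g opseq set" where
  "SY Y = \<Inter>{\<A>. \<A> \<subseteq> FY Y
      \<and> (\<forall>A\<in>BDO. (\<lambda>n. proj (Y n) \<circ> A \<circ> proj (Y n)) \<in> \<A>)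
      \<and> (\<forall>A\<in>\<A>. \<forall>B\<in>\<A>. seq_add A B \<in> \<A> \<and> seq_mul A B \<in> \<A>)
      \<and> (\<forall>c. \<forall>A\<in>\<A>. seq_smul c A \<in> \<A>)
      \<and> (\<forall>A\<in>\<A>. seq_adj A \<in> \<A>)
      \<and> seq_closed Y \<A>}"

text \<open>J_Y(BDO): elements of S_Y whose strong limit W((A_n)) = s-lim A_n P_{Y_n} is 0
(note A_n P_{Y_n} = A_n in our representation).\<close>
definition JY :: "(nat \<Rightarrow> 'g::group_add set) \<Rightarrow> 'g opseq set" where
  "JY Y = {A \<in> SY Y. \<forall>u\<in>l2. (\<lambda>n. l2norm (A n (proj (Y n) u))) \<longlonglongrightarrow> 0}"

definition closed_ideal_gen :: "(nat \<Rightarrow> 'g set) \<Rightarrow> 'g opseq set \<Rightarrow> 'g opseq set \<Rightarrow> 'g opseq set" where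
  "closed_ideal_gen Y S G = \<Inter>{I. I \<subseteq> S \<and> G \<subseteq> I
      \<and> (\<forall>A\<in>I. \<forall>B\<in>I. seq_add A B \<in> I)
      \<and> (\<forall>c. \<forall>A\<in>I. seq_smul c A \<in> I)
      \<and> (\<forall>A\<in>I. \<forall>B\<in>S. seq_mul A B \<in> I \<and> seq_mul B A \<in> I)
      \<and> seq_closed Y I}"

definition int_Om :: "'g::group_add set \<Rightarrow> 'g set \<Rightarrow> 'g set" where
  "int_Om \<Omega> A = {a \<in> A. \<forall>\<omega>\<in>\<Omega>. \<omega> + a \<in> A}"

definition bdry_Om :: "'g::group_add set \<Rightarrow> 'g set \<Rightarrow> 'g set" where
  "bdry_Om \<Omega> A = A - int_Om \<Omega> A"

inductive_set sgrp_gen :: "'g::group_add set \<Rightarrow> 'g set" for \<Omega> where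
  base: "\<omega> \<in> \<Omega> \<Longrightarrow> \<omega> \<in> sgrp_gen \<Omega>"
| step: "\<omega> \<in> \<Omega> \<Longrightarrow> x \<in> sgrp_gen \<Omega> \<Longrightarrow> \<omega> + x \<in> sgrp_gen \<Omega>"

end

theory Submission
  imports Defs
begin

text \<open>
A product of generators that carries a point of \<open>Y n\<close> out of \<open>Y n\<close> has to pass through the
\<open>\<Omega>\<close>-boundary. Hence the projections onto \<open>{s \<in> Y n. r + s \<notin> Y n}\<close> lie, for every \<open>r\<close>, in the
closed ideal \<open>I\<close> generated by the boundary projections, and so do the semi-commutators
\<open>P S T P - P S P T P = P S (1 - P) T P\<close>: for a shift \<open>T\<close> this is the previous remark, for a
multiplication operator it vanishes, and the general case of \<open>S, T \<in> BDO\<close> follows because the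
property is stable under sums, products and norm limits in \<open>T\<close>. Consequently the sequences
\<open>P T P + J\<close> with \<open>T \<in> BDO\<close> and \<open>J \<in> I\<close> form a \<open>*\<close>-algebra, which is dense in \<open>S_Y\<close>. Elements of \<open>I\<close>
converge strongly to 0, so if such a sequence is \<open>\<epsilon>\<close>-close to an element of \<open>J_Y\<close>, its strong limit
\<open>T\<close> has norm at most \<open>\<epsilon>\<close>, and \<open>J\<close> alone is \<open>2 \<epsilon>\<close>-close to it. Approximating in this way avoids
the completeness of \<open>l2\<close>.
\<close>

section \<open>Square-summable functions\<close>

text \<open>The obstacle hidden in "elements of the ideal converge strongly to 0" is right
  multiplication: if \<open>A\<close> is strongly null, \<open>A n (B n u)\<close> need not tend to
  0 for a merely bounded \<open>B\<close>; the vectors \<open>B n u\<close> themselves have to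
  stabilise. So every element of \<open>SY Y\<close> must first be shown to converge strongly, and
  since taking adjoints is not strongly continuous, this is done for a sequence and its adjoint
  together. Convergence is recorded as a Cauchy property, so that no limit operator is ever
  constructed; the only limits that occur are \<open>T\<close>, for its own compressions, and 0. In
  the same spirit adjoints are built from matrix coefficients instead of the Riesz theorem. The sums
  \<open>P T P + J\<close> need not be shown to form a closed set: density suffices, because the
  ideal is closed by definition. The last step rests on the fact that a compression of
  \<open>T\<close> has norm at most that of \<open>T\<close>: smallness of the strong limit bounds
  all compressions at once, which turns strong information into an estimate in the supremum
  norm.\<close>

lemma l2_finite_bound:
  assumes "\<And>F. finite F \<Longrightarrow> L2_set (\<lambda>t. cmod (u t)) F \<le> c"
  shows "u \<in> l2" and "l2norm u \<le> c"
proof -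
  have c0: "0 \<le> c" using assms[of "{}"] by simp
  have b: "sum (\<lambda>t. (cmod (u t))^2) F \<le> c^2" if "finite F" for F
  proof -
    have "sqrt (sum (\<lambda>t. (cmod (u t))^2) F) \<le> c" using assms[OF that] by (simp add: L2_set_def)
    then show ?thesis using c0 by (metis real_sqrt_le_iff real_sqrt_abs abs_of_nonneg)
  qed
  have s: "(\<lambda>t. (cmod (u t))^2) summable_on UNIV"
    by (rule nonneg_bdd_above_summable_on) (auto intro!: bdd_aboveI[of _ "c^2"] b)
  then show "u \<in> l2" by (simp add: l2_def)
  have "infsum (\<lambda>t. (cmod (u t))^2) UNIV \<le> c^2"
    by (rule infsum_le_finite_sums[OF s]) (use b in auto)
  then show "l2norm u \<le> c" unfolding l2norm_def using c0 by (simp add: real_le_lsqrt)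
qed

text \<open>Passing to finite subsets makes the triangle and Cauchy-Schwarz inequalities for
  \<open>L2_set\<close> available; \<open>l2_finite_bound\<close> leads back.\<close>

lemma L2_set_le_l2norm:
  assumes "u \<in> l2" "finite F"
  shows "L2_set (\<lambda>t. cmod (u t)) F \<le> l2norm u"
proof -
  have "sum (\<lambda>t. (cmod (u t))^2) F \<le> infsum (\<lambda>t. (cmod (u t))^2) UNIV"
    using assms by (intro finite_sum_le_infsum) (auto simp: l2_def)
  then show ?thesis by (simp add: L2_set_def l2norm_def)
qed

lemma l2norm_nonneg [simp]: "0 \<le> l2norm u"
  by (simp add: l2norm_def infsum_nonneg)

lemma
  assumes "u \<in> l2" "v \<in> l2"
  shows l2_add: "(\<lambda>t. u t + v t) \<in> l2"
    and l2norm_triangle: "l2norm (\<lambda>t. u t + v t) \<le> l2norm u + l2norm v"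
proof -
  have "L2_set (\<lambda>t. cmod (u t + v t)) F \<le> l2norm u + l2norm v" if "finite F" for F
  proof -
    have "L2_set (\<lambda>t. cmod (u t + v t)) F \<le> L2_set (\<lambda>t. cmod (u t) + cmod (v t)) F"
      by (intro L2_set_mono) (auto intro: norm_triangle_ineq)
    also have "\<dots> \<le> L2_set (\<lambda>t. cmod (u t)) F + L2_set (\<lambda>t. cmod (v t)) F"
      by (rule L2_set_triangle_ineq)
    finally show ?thesis using L2_set_le_l2norm[OF assms(1) that] L2_set_le_l2norm[OF assms(2) that] by linarith
  qed
  from l2_finite_bound[OF this]
  show "(\<lambda>t. u t + v t) \<in> l2" "l2norm (\<lambda>t. u t + v t) \<le> l2norm u + l2norm v" by auto
qed

lemma
  assumes "v \<in> l2" "\<And>t. cmod (u t) \<le> c * cmod (v t)" "0 \<le> c"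
  shows l2_dominated: "u \<in> l2" and l2norm_dominated: "l2norm u \<le> c * l2norm v"
proof -
  have "L2_set (\<lambda>t. cmod (u t)) F \<le> c * l2norm v" if "finite F" for F
  proof -
    have "L2_set (\<lambda>t. cmod (u t)) F \<le> L2_set (\<lambda>t. c * cmod (v t)) F"
      by (intro L2_set_mono assms(2)) auto
    also have "\<dots> = c * L2_set (\<lambda>t. cmod (v t)) F" by (simp add: L2_set_right_distrib assms(3))
    finally show ?thesis using mult_left_mono[OF L2_set_le_l2norm[OF assms(1) that] assms(3)] by linarith
  qed
  from l2_finite_bound[OF this] show "u \<in> l2" "l2norm u \<le> c * l2norm v" by auto
qed

lemma l2_smul: "u \<in> l2 \<Longrightarrow> (\<lambda>t. c * u t) \<in> l2"
  by (rule l2_dominated[of u _ "cmod c"]) (auto simp: norm_mult)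

lemma l2norm_smul: "l2norm (\<lambda>t. c * u t) = cmod c * l2norm u"
proof -
  have "infsum (\<lambda>t. (cmod (c * u t))\<^sup>2) UNIV = (cmod c)^2 * infsum (\<lambda>t. (cmod (u t))\<^sup>2) UNIV"
    by (simp add: norm_mult power_mult_distrib infsum_cmult_right')
  then show ?thesis by (simp add: l2norm_def real_sqrt_mult)
qed

lemma l2_zero [simp]: "(\<lambda>t. 0) \<in> l2" and l2norm_zero [simp]: "l2norm (\<lambda>t. 0) = 0"
  by (auto simp: l2_def l2norm_def)

lemma l2_diff: "u \<in> l2 \<Longrightarrow> v \<in> l2 \<Longrightarrow> (\<lambda>t. u t - v t) \<in> l2"
  using l2_add[of u "\<lambda>t. (-1) * v t"] l2_smul[of v "-1"] by simp

lemma l2norm_minus_commute: "l2norm (\<lambda>t. u t - v t) = l2norm (\<lambda>t. v t - u t)"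
  by (simp add: l2norm_def norm_minus_commute)

lemma l2norm_triangle_diff: "u \<in> l2 \<Longrightarrow> v \<in> l2 \<Longrightarrow> l2norm (\<lambda>t. u t - v t) \<le> l2norm u + l2norm v"
  using l2norm_triangle[of u "\<lambda>t. (-1) * v t"] l2_smul[of v "-1"] l2norm_smul[of "-1" v] by simp

lemma l2norm_diff_trans:
  "u \<in> l2 \<Longrightarrow> v \<in> l2 \<Longrightarrow> w \<in> l2 \<Longrightarrow>
   l2norm (\<lambda>t. u t - w t) \<le> l2norm (\<lambda>t. u t - v t) + l2norm (\<lambda>t. v t - w t)"
  using l2norm_triangle[of "\<lambda>t. u t - v t" "\<lambda>t. v t - w t"] l2_diff by fastforce

lemma l2norm_diff_bound: "u \<in> l2 \<Longrightarrow> v \<in> l2 \<Longrightarrow> l2norm u \<le> l2norm v + l2norm (\<lambda>t. u t - v t)"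
  using l2norm_triangle[of v "\<lambda>t. u t - v t"] l2_diff by fastforce

lemma norm_le_l2norm: "u \<in> l2 \<Longrightarrow> cmod (u t) \<le> l2norm u"
  using L2_set_le_l2norm[of u "{t}"] by (simp add: L2_set_def)

lemma l2_finite_support:
  assumes "finite F"
  shows "(\<lambda>t. if t \<in> F then u t else 0) \<in> l2"
    and "l2norm (\<lambda>t. if t \<in> F then u t else 0) = L2_set (\<lambda>t. cmod (u t)) F"
proof -
  let ?f = "\<lambda>t. (cmod (if t \<in> F then u t else 0))\<^sup>2"
  have "(?f has_sum sum (\<lambda>t. (cmod (u t))\<^sup>2) F) UNIV"
    using assms by (intro has_sum_cong_neutral[THEN iffD1, OF _ _ _ has_sum_finite[of F "\<lambda>t. (cmod (u t))\<^sup>2"]]) auto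
  then show "(\<lambda>t. if t \<in> F then u t else 0) \<in> l2"
    and "l2norm (\<lambda>t. if t \<in> F then u t else 0) = L2_set (\<lambda>t. cmod (u t)) F"
    by (auto simp: l2_def l2norm_def L2_set_def infsumI summable_on_def)
qed

lemma
  assumes "u \<in> l2" "v \<in> l2"
  shows l2inner_summable: "(\<lambda>t. cnj (u t) * v t) summable_on UNIV"
    and l2inner_bound: "cmod (l2inner u v) \<le> l2norm u * l2norm v"
proof -
  have b: "sum (\<lambda>t. cmod (cnj (u t) * v t)) F \<le> l2norm u * l2norm v" if "finite F" for F
  proof -
    have "sum (\<lambda>t. cmod (cnj (u t) * v t)) F \<le> L2_set (\<lambda>t. cmod (u t)) F * L2_set (\<lambda>t. cmod (v t)) F"
      using L2_set_mult_ineq[of "\<lambda>t. cmod (u t)" "\<lambda>t. cmod (v t)" F] by (simp add: norm_mult)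
    also have "\<dots> \<le> l2norm u * l2norm v"
      by (intro mult_mono L2_set_le_l2norm assms that) auto
    finally show ?thesis .
  qed
  have s: "(\<lambda>t. cmod (cnj (u t) * v t)) summable_on UNIV"
    by (rule nonneg_bdd_above_summable_on) (auto intro!: bdd_aboveI[of _ "l2norm u * l2norm v"] b)
  then show "(\<lambda>t. cnj (u t) * v t) summable_on UNIV"
    by (rule abs_summable_summable)
  have "cmod (l2inner u v) \<le> infsum (\<lambda>t. cmod (cnj (u t) * v t)) UNIV"
    unfolding l2inner_def by (rule norm_infsum_bound) (use s in auto)
  also have "\<dots> \<le> l2norm u * l2norm v"
    by (rule infsum_le_finite_sums[OF s]) (use b in auto)
  finally show "cmod (l2inner u v) \<le> l2norm u * l2norm v" .
qed

lemma l2inner_cnj: "l2inner u v = cnj (l2inner v u)"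
  by (simp add: l2inner_def mult.commute flip: infsum_cnj)

lemma l2inner_add_right:
  "u \<in> l2 \<Longrightarrow> v \<in> l2 \<Longrightarrow> w \<in> l2 \<Longrightarrow> l2inner u (\<lambda>t. v t + w t) = l2inner u v + l2inner u w"
  using infsum_add[OF l2inner_summable[of u v] l2inner_summable[of u w]]
  by (simp add: l2inner_def algebra_simps)

lemma l2inner_smul_right: "l2inner u (\<lambda>t. c * v t) = c * l2inner u v"
  by (simp add: l2inner_def mult.left_commute infsum_cmult_right')

lemma l2inner_add_left:
  "u \<in> l2 \<Longrightarrow> v \<in> l2 \<Longrightarrow> w \<in> l2 \<Longrightarrow> l2inner (\<lambda>t. v t + w t) u = l2inner v u + l2inner w u"
  using infsum_add[OF l2inner_summable[of v u] l2inner_summable[of w u]]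
  by (simp add: l2inner_def algebra_simps)

lemma l2inner_smul_left: "l2inner (\<lambda>t. c * v t) u = cnj c * l2inner v u"
  by (simp add: l2inner_def mult.assoc infsum_cmult_right')

lemma l2inner_diff_right:
  "u \<in> l2 \<Longrightarrow> v \<in> l2 \<Longrightarrow> w \<in> l2 \<Longrightarrow> l2inner u (\<lambda>t. v t - w t) = l2inner u v - l2inner u w"
  using l2inner_add_right[of u v "\<lambda>t. (-1) * w t"] l2_smul[of w "-1"] l2inner_smul_right[of u "-1" w] by simp

lemma l2inner_self:
  assumes "u \<in> l2"
  shows "l2inner u u = of_real ((l2norm u)^2)"
proof -
  have "infsum (\<lambda>t. cnj (u t) * u t) UNIV = infsum (\<lambda>t. of_real ((cmod (u t))^2) :: complex) UNIV"
    by (intro infsum_cong) (metis complex_norm_square mult.commute)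
  also have "\<dots> = of_real (infsum (\<lambda>t. (cmod (u t))^2) UNIV)"
    using assms by (intro infsumI has_sum_of_real_iff[THEN iffD2] has_sum_infsum) (simp add: l2_def)
  finally show ?thesis by (simp add: l2inner_def l2norm_def infsum_nonneg)
qed

lemma l2norm_eq_0: "u \<in> l2 \<Longrightarrow> l2norm u = 0 \<Longrightarrow> u = (\<lambda>t. 0)"
  using norm_le_l2norm[of u] by (metis norm_le_zero_iff)

lemma l2_eqI_inner:
  assumes "v \<in> l2" "w \<in> l2" "\<And>u. u \<in> l2 \<Longrightarrow> l2inner u v = l2inner u w"
  shows "v = w"
proof -
  let ?d = "\<lambda>t. v t - w t"
  have d: "?d \<in> l2" by (rule l2_diff[OF assms(1,2)])
  have "l2inner ?d ?d = 0" using l2inner_diff_right[OF d assms(1,2)] assms(3)[OF d] by simp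
  then have "l2norm ?d = 0" using l2inner_self[OF d] by simp
  then have "?d = (\<lambda>t. 0)" by (rule l2norm_eq_0[OF d])
  then show ?thesis by (metis eq_iff_diff_eq_0 ext)
qed

text \<open>Density of the finitely supported vectors. It carries the continuity argument for
  adjoints and the strong convergence of the projections attached to \<open>Y\<close>.\<close>

lemma l2_tail:
  assumes "u \<in> l2" "0 < e"
  obtains F where "finite F" "l2norm (\<lambda>t. if t \<in> F then 0 else u t) < e"
proof -
  let ?f = "\<lambda>t. (cmod (u t))^2"
  have s: "?f summable_on UNIV" using assms by (simp add: l2_def)
  obtain F where F: "finite F" "dist (sum ?f F) (infsum ?f UNIV) < e^2"
  proof -
    have e: "e^2/2 < e^2" "0 < e^2/2" using assms(2) by auto
    show ?thesis using infsum_finite_approximation[OF s e(2)] e(1) that by (meson le_less_trans)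
  qed
  have sF: "?f summable_on (-F)" by (rule summable_on_subset_banach[OF s]) auto
  have "infsum ?f (F \<union> -F) = sum ?f F + infsum ?f (-F)"
    using infsum_Un_disjoint[of ?f F "-F"] F sF by auto
  then have "infsum ?f (-F) < e^2" using F(2) by (simp add: dist_real_def)
  moreover have "infsum (\<lambda>t. (cmod (if t \<in> F then 0 else u t))^2) UNIV = infsum ?f (-F)"
    by (intro infsum_cong_neutral) auto
  ultimately have "l2norm (\<lambda>t. if t \<in> F then 0 else u t) < e"
    unfolding l2norm_def using assms(2) by (metis less_le real_sqrt_less_mono real_sqrt_abs abs_of_nonneg)
  with F(1) show thesis by (rule that)
qed

section \<open>Bounded operators and their adjoints\<close>

text \<open>For bounded operators and nonnegative \<open>e\<close> this is
  \<open>opnorm (op_diff A B) \<le> e\<close>, see \<open>opnorm_diff_le_iff\<close>. The vectorwise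
  form keeps suprema, and the boundedness conditions they require, out of the estimates.\<close>

definition op_within :: "real \<Rightarrow> 'g op \<Rightarrow> 'g op \<Rightarrow> bool" where
  "op_within e A B \<longleftrightarrow> (\<forall>u\<in>l2. l2norm (\<lambda>t. A u t - B u t) \<le> e * l2norm u)"

lemma bop_l2: "is_bop A \<Longrightarrow> u \<in> l2 \<Longrightarrow> A u \<in> l2"
  and bop_outside: "is_bop A \<Longrightarrow> u \<notin> l2 \<Longrightarrow> A u = (\<lambda>t. 0)"
  and bop_add: "is_bop A \<Longrightarrow> u \<in> l2 \<Longrightarrow> v \<in> l2 \<Longrightarrow> A (\<lambda>t. u t + v t) = (\<lambda>t. A u t + A v t)"
  and bop_smul: "is_bop A \<Longrightarrow> u \<in> l2 \<Longrightarrow> A (\<lambda>t. c * u t) = (\<lambda>t. c * A u t)"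
  by (auto simp: is_bop_def zvec_def)

lemma bop_diff: "is_bop A \<Longrightarrow> u \<in> l2 \<Longrightarrow> v \<in> l2 \<Longrightarrow> A (\<lambda>t. u t - v t) = (\<lambda>t. A u t - A v t)"
  using bop_add[of A u "\<lambda>t. (-1) * v t"] l2_smul[of v "-1"] bop_smul[of A v "-1"] by simp

lemma bop_zero: "is_bop A \<Longrightarrow> A (\<lambda>t. 0) = (\<lambda>t. 0)"
  using bop_smul[of A "\<lambda>t. 0" 0] by simp

lemma bopI:
  assumes "\<And>u. u \<in> l2 \<Longrightarrow> A u \<in> l2" "\<And>u. u \<notin> l2 \<Longrightarrow> A u = (\<lambda>t. 0)"
    "\<And>u v. u \<in> l2 \<Longrightarrow> v \<in> l2 \<Longrightarrow> A (\<lambda>t. u t + v t) = (\<lambda>t. A u t + A v t)"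
    "\<And>c u. u \<in> l2 \<Longrightarrow> A (\<lambda>t. c * u t) = (\<lambda>t. c * A u t)"
    "\<And>u. u \<in> l2 \<Longrightarrow> l2norm (A u) \<le> C * l2norm u"
  shows "is_bop A"
  using assms unfolding is_bop_def zvec_def by blast

text \<open>The \<open>Sup\<close> in \<open>opnorm\<close> says something only once its set is
  bounded above, which the constant from \<open>is_bop\<close> provides; the inequality then follows
  by rescaling \<open>u\<close> to norm 1.\<close>

lemma opnorm_bound:
  assumes "is_bop A" "u \<in> l2"
  shows "l2norm (A u) \<le> opnorm A * l2norm u"
proof -
  obtain C where C: "\<And>u. u \<in> l2 \<Longrightarrow> l2norm (A u) \<le> C * l2norm u"
    using assms(1) unfolding is_bop_def by blast
  have bdd: "bdd_above {l2norm (A u) | u. u \<in> l2 \<and> l2norm u \<le> 1}"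
  proof (rule bdd_aboveI)
    fix x assume "x \<in> {l2norm (A u) | u. u \<in> l2 \<and> l2norm u \<le> 1}"
    then obtain u where u: "u \<in> l2" "l2norm u \<le> 1" "x = l2norm (A u)" by auto
    have "C * l2norm u \<le> \<bar>C\<bar> * 1" using u by (intro mult_mono) auto
    then show "x \<le> \<bar>C\<bar>" using C[OF u(1)] u(3) by linarith
  qed
  show ?thesis
  proof (cases "l2norm u = 0")
    case True
    then show ?thesis using C[OF assms(2)] by simp
  next
    case False
    define c where "c = complex_of_real (1 / l2norm u)"
    have pos: "0 < l2norm u" using False l2norm_nonneg[of u] by linarith
    have "l2norm (\<lambda>t. c * u t) = 1" using pos by (simp only: l2norm_smul) (simp add: c_def norm_divide)
    then have "l2norm (A (\<lambda>t. c * u t)) \<le> opnorm A"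
      unfolding opnorm_def using l2_smul[OF assms(2)] by (intro cSup_upper[OF _ bdd]) force
    moreover have "l2norm (A (\<lambda>t. c * u t)) = l2norm (A u) / l2norm u"
      using pos by (simp add: bop_smul[OF assms] l2norm_smul) (simp add: c_def norm_divide)
    ultimately show ?thesis using pos by (simp add: divide_le_eq)
  qed
qed

lemma opnorm_leI:
  assumes "\<And>u. u \<in> l2 \<Longrightarrow> l2norm (A u) \<le> c * l2norm u" "0 \<le> c"
  shows "opnorm A \<le> c"
  unfolding opnorm_def
proof (rule cSup_least)
  show "{l2norm (A u) |u. u \<in> l2 \<and> l2norm u \<le> 1} \<noteq> {}" using l2norm_zero l2_zero
    by (metis (mono_tags, lifting) empty_Collect_eq zero_le_one)
  fix x assume "x \<in> {l2norm (A u) |u. u \<in> l2 \<and> l2norm u \<le> 1}"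
  then obtain u where u: "u \<in> l2" "l2norm u \<le> 1" "x = l2norm (A u)" by auto
  show "x \<le> c" using assms(1)[OF u(1)] mult_left_mono[OF u(2) assms(2)] u(3) by simp
qed

lemma opnorm_nonneg:
  assumes "is_bop A"
  shows "0 \<le> opnorm A"
proof -
  obtain C where C: "\<And>u. u \<in> l2 \<Longrightarrow> l2norm (A u) \<le> C * l2norm u"
    using assms(1) unfolding is_bop_def by blast
  show ?thesis
  proof (cases "\<exists>u\<in>l2. l2norm (A u) \<noteq> 0")
    case True
    then obtain u where u: "u \<in> l2" "0 < l2norm (A u)" using l2norm_nonneg by (metis less_le)
    then have "0 < opnorm A * l2norm u" using opnorm_bound[OF assms u(1)] by linarith
    then show ?thesis by (simp add: zero_less_mult_iff) (meson l2norm_nonneg not_less less_imp_le)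
  next
    case False
    then have "{l2norm (A u) |u. u \<in> l2 \<and> l2norm u \<le> 1} = {0}"
      by (auto intro!: exI[of _ "\<lambda>t. 0"])
    then show ?thesis by (simp add: opnorm_def)
  qed
qed

lemma opnorm_le_iff:
  "is_bop A \<Longrightarrow> 0 \<le> c \<Longrightarrow> opnorm A \<le> c \<longleftrightarrow> (\<forall>u\<in>l2. l2norm (A u) \<le> c * l2norm u)"
  using opnorm_leI[of A c] opnorm_bound[of A]
  by (meson l2norm_nonneg mult_right_mono order_trans)

lemma bop_op_add [intro]:
  assumes "is_bop A" "is_bop B"
  shows "is_bop (op_add A B)"
proof (rule bopI[where C="opnorm A + opnorm B"])
  fix u :: "'a vec" assume u: "u \<in> l2"
  show "op_add A B u \<in> l2" using assms u by (simp add: op_add_def bop_l2 l2_add)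
  show "op_add A B (\<lambda>t. c * u t) = (\<lambda>t. c * op_add A B u t)" for c
    using assms u by (simp add: op_add_def bop_smul algebra_simps)
  show "l2norm (op_add A B u) \<le> (opnorm A + opnorm B) * l2norm u"
    using l2norm_triangle[OF bop_l2[OF assms(1) u] bop_l2[OF assms(2) u]]
      opnorm_bound[OF assms(1) u] opnorm_bound[OF assms(2) u]
    by (simp add: op_add_def algebra_simps)
qed (use assms in \<open>auto simp: op_add_def bop_outside bop_add algebra_simps\<close>)

lemma bop_op_smul [intro]:
  assumes "is_bop A"
  shows "is_bop (op_smul c A)"
proof (rule bopI[where C="cmod c * opnorm A"])
  fix u :: "'a vec" assume u: "u \<in> l2"
  show "l2norm (op_smul c A u) \<le> cmod c * opnorm A * l2norm u"
    using mult_left_mono[OF opnorm_bound[OF assms(1) u], of "cmod c"]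
    by (simp add: op_smul_def l2norm_smul mult.assoc)
qed (use assms in \<open>auto simp: op_smul_def bop_l2 l2_smul bop_outside bop_add bop_smul algebra_simps\<close>)

lemma op_diff_eq: "op_diff A B = op_add A (op_smul (-1) B)"
  by (simp add: op_diff_def op_add_def op_smul_def)

lemma bop_op_diff [intro]: "is_bop A \<Longrightarrow> is_bop B \<Longrightarrow> is_bop (op_diff A B)"
  unfolding op_diff_eq by blast

lemma bop_comp [intro]:
  assumes "is_bop A" "is_bop B"
  shows "is_bop (A \<circ> B)"
proof (rule bopI[where C="opnorm A * opnorm B"])
  fix u :: "'a vec" assume u: "u \<in> l2"
  show "l2norm ((A \<circ> B) u) \<le> opnorm A * opnorm B * l2norm u"
    using opnorm_bound[OF assms(1) bop_l2[OF assms(2) u]]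
      mult_left_mono[OF opnorm_bound[OF assms(2) u] opnorm_nonneg[OF assms(1)]]
    by (simp add: mult.assoc)
qed (use assms in \<open>auto simp: bop_l2 bop_outside bop_add bop_smul bop_zero\<close>)

lemma l2_mult_bounded:
  assumes "u \<in> l2" "\<And>t. cmod (a t) \<le> c"
  shows "(\<lambda>t. a t * u t) \<in> l2" "l2norm (\<lambda>t. a t * u t) \<le> c * l2norm u"
proof -
  have "0 \<le> c" using assms(2) norm_ge_zero order_trans by blast
  moreover have "cmod (a t * u t) \<le> c * cmod (u t)" for t
    using assms(2) by (simp add: norm_mult mult_right_mono)
  ultimately show "(\<lambda>t. a t * u t) \<in> l2" "l2norm (\<lambda>t. a t * u t) \<le> c * l2norm u"
    by (rule l2_dominated[OF assms(1), rotated], rule l2norm_dominated[OF assms(1), rotated])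
qed

lemma bop_mult_op [intro]:
  assumes "bdd_above (range (\<lambda>t. cmod (a t)))"
  shows "is_bop (mult_op a)"
proof -
  obtain c where c: "\<And>t. cmod (a t) \<le> c" using assms by (auto simp: bdd_above_def)
  show ?thesis
    by (rule bopI[where C=c])
      (auto simp: mult_op_def l2_mult_bounded[OF _ c] l2_add l2_smul distrib_left mult.left_commute zvec_def)
qed

lemma proj_eq_mult_op: "proj X = mult_op (\<lambda>t. if t \<in> X then 1 else 0)"
  by (auto simp: proj_def mult_op_def fun_eq_iff)

lemma bop_proj [intro, simp]: "is_bop (proj X)"
  unfolding proj_eq_mult_op by (rule bop_mult_op) (auto intro!: bdd_aboveI[of _ 1])

lemma proj_apply: "u \<in> l2 \<Longrightarrow> proj X u = (\<lambda>t. if t \<in> X then u t else 0)"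
  by (simp add: proj_def)

lemma proj_l2 [simp]: "proj X u \<in> l2"
  by (cases "u \<in> l2") (auto simp: bop_l2 bop_outside)

lemma l2norm_proj_le: "u \<in> l2 \<Longrightarrow> l2norm (proj X u) \<le> l2norm u"
  using l2norm_dominated[of u "proj X u" 1] by (simp add: proj_apply)

lemma proj_comp: "proj X \<circ> proj X' = proj (X \<inter> X')"
  by (auto simp: fun_eq_iff proj_def l2_dominated[where c=1] zvec_def)

lemma
  fixes r :: "'a::group_add"
  assumes "u \<in> l2"
  shows l2_translate: "(\<lambda>t. u (r + t)) \<in> l2"
    and l2norm_translate: "l2norm (\<lambda>t. u (r + t)) = l2norm u"
proof -
  have b: "bij_betw ((+) r) UNIV (UNIV :: 'a::group_add set)"
    by (rule bij_betwI[where g="(+) (-r)"]) (auto simp: add.assoc[symmetric])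
  show "(\<lambda>t. u (r + t)) \<in> l2"
    using assms summable_on_reindex_bij_betw[OF b, of "\<lambda>t. (cmod (u t))^2"] by (simp add: l2_def)
  show "l2norm (\<lambda>t. u (r + t)) = l2norm u"
    using infsum_reindex_bij_betw[OF b, of "\<lambda>t. (cmod (u t))^2"] by (simp add: l2norm_def)
qed

lemma l2inner_translate: "l2inner (\<lambda>t. u (r + t)) (\<lambda>t. v (r + t)) = l2inner u v"
  for r :: "'a::group_add"
proof -
  have b: "bij_betw ((+) r) UNIV (UNIV :: 'a::group_add set)"
    by (rule bij_betwI[where g="(+) (-r)"]) (auto simp: add.assoc[symmetric])
  show ?thesis
    using infsum_reindex_bij_betw[OF b, of "\<lambda>t. cnj (u t) * v t"] by (simp add: l2inner_def)
qed

lemma bop_shift [intro, simp]: "is_bop (shift r)"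
  by (rule bopI[where C=1])
    (auto simp: shift_def l2_translate l2norm_translate l2_add l2_smul zvec_def)

lemma shift_apply: "u \<in> l2 \<Longrightarrow> shift r u = (\<lambda>t. u (- r + t))"
  by (simp add: shift_def)

lemma opnorm_diff_le_iff:
  "is_bop A \<Longrightarrow> is_bop B \<Longrightarrow> 0 \<le> e \<Longrightarrow> opnorm (op_diff A B) \<le> e \<longleftrightarrow> op_within e A B"
  by (simp add: opnorm_le_iff bop_op_diff op_within_def) (simp add: op_diff_def)

lemma op_within_refl: "0 \<le> e \<Longrightarrow> op_within e A A"
  by (simp add: op_within_def)

lemma op_within_mono: "op_within e A B \<Longrightarrow> e \<le> e' \<Longrightarrow> op_within e' A B"
  by (meson op_within_def l2norm_nonneg mult_right_mono order_trans)

lemma op_within_trans: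
  assumes "is_bop A" "is_bop B" "is_bop C" "op_within e A B" "op_within e' B C"
  shows "op_within (e + e') A C"
  unfolding op_within_def
proof
  fix u :: "'a vec" assume u: "u \<in> l2"
  show "l2norm (\<lambda>t. A u t - C u t) \<le> (e + e') * l2norm u"
    using l2norm_diff_trans[of "A u" "B u" "C u"] assms u by (force simp: op_within_def bop_l2 algebra_simps)
qed

lemma op_within_add:
  assumes "is_bop A" "is_bop A'" "is_bop B" "is_bop B'" "op_within e A A'" "op_within e' B B'"
  shows "op_within (e + e') (op_add A B) (op_add A' B')"
  unfolding op_within_def
proof
  fix u :: "'a vec" assume u: "u \<in> l2"
  have "l2norm (\<lambda>t. (A u t - A' u t) + (B u t - B' u t)) \<le> (e + e') * l2norm u"
    using l2norm_triangle[of "\<lambda>t. A u t - A' u t" "\<lambda>t. B u t - B' u t"] assms u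
    by (force simp: op_within_def bop_l2 l2_diff algebra_simps)
  then show "l2norm (\<lambda>t. op_add A B u t - op_add A' B' u t) \<le> (e + e') * l2norm u"
    by (simp add: op_add_def algebra_simps)
qed

lemma op_within_smul:
  assumes "op_within e A A'"
  shows "op_within (cmod c * e) (op_smul c A) (op_smul c A')"
  unfolding op_within_def
proof
  fix u :: "'a vec" assume u: "u \<in> l2"
  have "(\<lambda>t. op_smul c A u t - op_smul c A' u t) = (\<lambda>t. c * (A u t - A' u t))"
    by (simp add: op_smul_def algebra_simps)
  then show "l2norm (\<lambda>t. op_smul c A u t - op_smul c A' u t) \<le> cmod c * e * l2norm u"
    using assms u by (simp add: l2norm_smul op_within_def mult.assoc mult_left_mono)
qed

lemma op_within_comp_left:
  assumes "is_bop A" "is_bop B" "is_bop B'" "op_within e B B'" "opnorm A \<le> c" "0 \<le> e"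
  shows "op_within (c * e) (A \<circ> B) (A \<circ> B')"
  unfolding op_within_def
proof
  fix u :: "'a vec" assume u: "u \<in> l2"
  have d: "(\<lambda>t. B u t - B' u t) \<in> l2" using assms u by (simp add: bop_l2 l2_diff)
  have "l2norm (A (\<lambda>t. B u t - B' u t)) \<le> opnorm A * l2norm (\<lambda>t. B u t - B' u t)"
    by (rule opnorm_bound[OF assms(1) d])
  also have "\<dots> \<le> c * (e * l2norm u)"
    using assms u opnorm_nonneg[OF assms(1)] by (intro mult_mono) (auto simp: op_within_def)
  finally show "l2norm (\<lambda>t. (A \<circ> B) u t - (A \<circ> B') u t) \<le> c * e * l2norm u"
    using assms u by (simp add: bop_diff bop_l2 mult.assoc)
qed

lemma op_within_comp_right:
  assumes "is_bop A" "op_within e B B'" "opnorm A \<le> c" "0 \<le> e"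
  shows "op_within (e * c) (B \<circ> A) (B' \<circ> A)"
  unfolding op_within_def
proof
  fix u :: "'a vec" assume u: "u \<in> l2"
  have "l2norm (\<lambda>t. B (A u) t - B' (A u) t) \<le> e * l2norm (A u)"
    using assms bop_l2[OF assms(1) u] by (simp add: op_within_def)
  also have "\<dots> \<le> e * (c * l2norm u)"
    using opnorm_bound[OF assms(1) u] mult_right_mono[OF assms(3), of "l2norm u"] assms(4)
    by (intro mult_left_mono) auto
  finally show "l2norm (\<lambda>t. (B \<circ> A) u t - (B' \<circ> A) u t) \<le> e * c * l2norm u"
    by (simp add: mult.assoc)
qed

lemma opnorm_comp_le:
  assumes "is_bop A" "is_bop B" "opnorm A \<le> a" "opnorm B \<le> b"
  shows "opnorm (A \<circ> B) \<le> a * b"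
proof (rule opnorm_leI)
  have ab: "0 \<le> a" "0 \<le> b" using assms opnorm_nonneg order_trans by blast+
  then show "0 \<le> a * b" by simp
  fix u :: "'a vec" assume u: "u \<in> l2"
  have "l2norm (A (B u)) \<le> a * l2norm (B u)"
    using opnorm_le_iff[OF assms(1) ab(1)] assms bop_l2[OF assms(2) u] by blast
  also have "\<dots> \<le> a * (b * l2norm u)"
    using opnorm_le_iff[OF assms(2) ab(2)] assms u ab by (intro mult_left_mono) auto
  finally show "l2norm ((A \<circ> B) u) \<le> a * b * l2norm u" by (simp add: mult.assoc)
qed

lemma opnorm_proj_le: "opnorm (proj X) \<le> 1"
  by (rule opnorm_leI) (auto simp: l2norm_proj_le)

section \<open>Existence and calculus of adjoints\<close>

definition adj_pair :: "'g op \<Rightarrow> 'g op \<Rightarrow> bool" where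
  "adj_pair A B \<longleftrightarrow> (\<forall>u\<in>l2. \<forall>v\<in>l2. l2inner (A u) v = l2inner u (B v))"

text \<open>Testing with unit vectors forces the coefficients of \<open>w\<close>. Testing with the
  truncation of \<open>w\<close> to a finite set bounds that truncation uniformly, so
  \<open>w\<close> is square-summable; the identity, clear for finitely supported \<open>u\<close>,
  extends by continuity.\<close>

lemma adjoint_vector_exists:
  assumes A: "is_bop A" and v: "v \<in> l2"
  shows "\<exists>w\<in>l2. \<forall>u\<in>l2. l2inner (A u) v = l2inner u w"
proof -
  \<comment> \<open>Unit vectors; membership in a singleton, in place of an equation, lets
    \<open>l2_finite_support\<close> apply directly.\<close>
  define e where "e x = (\<lambda>t. if t \<in> {x} then 1 else 0 :: complex)" for x :: 'a
  have e: "e x \<in> l2" for x unfolding e_def by (rule l2_finite_support) simp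
  define w where "w x = l2inner (A (e x)) v" for x
  have fin: "l2inner (A (\<lambda>t. if t \<in> F then u t else 0)) v = (\<Sum>t\<in>F. cnj (u t) * w t)" if "finite F" for F u
    using that
  proof induction
    case empty
    then show ?case by (simp add: bop_zero[OF A]) (simp add: l2inner_def)
  next
    case (insert x F)
    let ?r = "\<lambda>t. if t \<in> F then u t else 0"
    have r: "?r \<in> l2" by (rule l2_finite_support) fact
    have "(\<lambda>t. if t \<in> insert x F then u t else 0) = (\<lambda>t. u x * e x t + ?r t)"
      using insert by (auto simp: e_def fun_eq_iff)
    then show ?case using insert
      by (simp add: bop_add[OF A l2_smul[OF e] r] bop_smul[OF A e] l2inner_add_left[OF v]
          l2_smul bop_l2[OF A] e r l2inner_smul_left w_def)
  qed
  have "L2_set (\<lambda>t. cmod (w t)) F \<le> opnorm A * l2norm v" if F: "finite F" for F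
  proof -
    \<comment> \<open>With the truncated \<open>w\<close> as test vector the inner product is the
      square of its own norm \<open>?x\<close>, so one factor \<open>?x\<close> cancels from the
      Cauchy-Schwarz bound.\<close>
    let ?r = "\<lambda>t. if t \<in> F then w t else 0"
    let ?x = "L2_set (\<lambda>t. cmod (w t)) F"
    have r: "?r \<in> l2" "l2norm ?r = ?x" using l2_finite_support[OF F] by auto
    have "(\<Sum>t\<in>F. cnj (w t) * w t) = of_real (?x^2)"
      by (simp add: L2_set_def sum_nonneg complex_norm_square[symmetric] mult.commute of_real_sum[symmetric]
          del: of_real_power of_real_sum)
    then have "?x^2 = cmod (l2inner (A ?r) v)" by (simp add: fin[OF F] norm_power)
    also have "\<dots> \<le> opnorm A * ?x * l2norm v"
      using l2inner_bound[OF bop_l2[OF A r(1)] v] mult_right_mono[OF opnorm_bound[OF A r(1)], of "l2norm v"] r(2)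
      by simp
    finally have "?x * ?x \<le> ?x * (opnorm A * l2norm v)" by (simp add: power2_eq_square mult_ac)
    then show ?thesis
      using opnorm_nonneg[OF A] L2_set_nonneg[of "\<lambda>t. cmod (w t)" F]
      by (cases "?x = 0") (auto simp: mult_le_cancel_left)
  qed
  then have w: "w \<in> l2" by (rule l2_finite_bound)
  have "l2inner (A u) v = l2inner u w" if u: "u \<in> l2" for u
  proof -
    \<comment> \<open>Both sides agree on the finitely supported part of \<open>u\<close>, and
      \<open>K\<close> times the norm of the tail bounds what is left.\<close>
    define K where "K = opnorm A * l2norm v + l2norm w"
    have K: "0 \<le> K" using opnorm_nonneg[OF A] by (simp add: K_def)
    have "cmod (l2inner (A u) v - l2inner u w) \<le> K * d" if d: "0 < d" for d
    proof -
      obtain F where F: "finite F" "l2norm (\<lambda>t. if t \<in> F then 0 else u t) < d"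
        using l2_tail[OF u d] .
      let ?r = "\<lambda>t. if t \<in> F then u t else 0"
      let ?s = "\<lambda>t. if t \<in> F then 0 else u t"
      have r: "?r \<in> l2" by (rule l2_finite_support) fact
      have s: "?s \<in> l2" using l2_dominated[OF u, of ?s 1] by auto
      have u_eq: "u = (\<lambda>t. ?r t + ?s t)" by auto
      have 1: "l2inner (A u) v = l2inner (A ?r) v + l2inner (A ?s) v"
        by (subst u_eq, subst bop_add[OF A r s], rule l2inner_add_left) (auto intro: v bop_l2[OF A] r s)
      have 2: "l2inner u w = l2inner ?r w + l2inner ?s w"
        by (subst u_eq, rule l2inner_add_left) (auto intro: w r s)
      have "l2inner ?r w = (\<Sum>t\<in>F. cnj (u t) * w t)"
        unfolding l2inner_def using F(1)
        by (simp add: infsum_finite[symmetric] del: infsum_finite) (intro infsum_cong_neutral, auto)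
      then have "cmod (l2inner (A u) v - l2inner u w) = cmod (l2inner (A ?s) v - l2inner ?s w)"
        using fin[OF F(1), of u] 1 2 by simp
      also have "\<dots> \<le> l2norm (A ?s) * l2norm v + l2norm ?s * l2norm w"
        using norm_triangle_ineq4[of "l2inner (A ?s) v" "l2inner ?s w"]
          l2inner_bound[OF bop_l2[OF A s] v] l2inner_bound[OF s w] by linarith
      also have "\<dots> \<le> (opnorm A * l2norm ?s) * l2norm v + l2norm ?s * l2norm w"
        by (intro add_mono mult_right_mono opnorm_bound[OF A s]) auto
      also have "\<dots> = K * l2norm ?s" by (simp add: K_def algebra_simps)
      also have "\<dots> \<le> K * d" using F(2) K by (intro mult_left_mono) auto
      finally show ?thesis .
    qed
    note bound = this
    have "cmod (l2inner (A u) v - l2inner u w) \<le> 0"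
    proof (rule field_le_epsilon)
      fix d :: real assume d: "0 < d"
      have "K * (d / (K + 1)) \<le> d" using K d by (simp add: field_simps)
      then show "cmod (l2inner (A u) v - l2inner u w) \<le> 0 + d"
        using bound[of "d / (K + 1)"] K d by simp
    qed
    then show ?thesis by simp
  qed
  with w show ?thesis by blast
qed

lemma
  assumes "is_bop A" "v \<in> l2"
  shows op_adj_l2: "op_adj A v \<in> l2"
    and l2inner_op_adj: "u \<in> l2 \<Longrightarrow> l2inner (A u) v = l2inner u (op_adj A v)"
proof -
  obtain w where w: "w \<in> l2" "\<forall>u\<in>l2. l2inner (A u) v = l2inner u w"
    using adjoint_vector_exists[OF assms] by blast
  have "(THE w. w \<in> l2 \<and> (\<forall>u\<in>l2. l2inner (A u) v = l2inner u w)) = w"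
    using w by (intro the_equality) (auto intro: l2_eqI_inner)
  then show "op_adj A v \<in> l2" "u \<in> l2 \<Longrightarrow> l2inner (A u) v = l2inner u (op_adj A v)"
    using w assms(2) by (auto simp: op_adj_def)
qed

text \<open>The adjoint identity at \<open>u = op_adj A v\<close> bounds the square of the norm of
  \<open>op_adj A v\<close> by a multiple of that norm; cancel one factor.\<close>

lemma l2norm_op_adj_le:
  assumes "is_bop A" "v \<in> l2"
  shows "l2norm (op_adj A v) \<le> opnorm A * l2norm v"
proof -
  let ?w = "op_adj A v"
  have w: "?w \<in> l2" by (rule op_adj_l2[OF assms])
  have "l2inner (A ?w) v = of_real ((l2norm ?w)^2)"
    using l2inner_op_adj[OF assms w] l2inner_self[OF w] by simp
  then have "(l2norm ?w)^2 \<le> l2norm (A ?w) * l2norm v"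
    using l2inner_bound[OF bop_l2[OF assms(1) w] assms(2)] by (simp add: norm_power)
  also have "\<dots> \<le> opnorm A * l2norm ?w * l2norm v"
    by (intro mult_right_mono opnorm_bound[OF assms(1) w]) auto
  finally have "l2norm ?w * l2norm ?w \<le> l2norm ?w * (opnorm A * l2norm v)"
    by (simp add: power2_eq_square mult_ac)
  then show ?thesis
    using opnorm_nonneg[OF assms(1)] l2norm_nonneg[of ?w]
    by (cases "l2norm ?w = 0") (auto simp: mult_le_cancel_left)
qed

text \<open>Linearity comes from uniqueness: both sides have the same inner product with every
  vector of \<open>l2\<close>.\<close>

lemma bop_op_adj [intro]:
  assumes A: "is_bop A"
  shows "is_bop (op_adj A)"
proof (rule bopI[where C="opnorm A"])
  note adj = op_adj_l2[OF A] l2inner_op_adj[OF A, symmetric]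
  show "op_adj A (\<lambda>t. u t + v t) = (\<lambda>t. op_adj A u t + op_adj A v t)" if uv: "u \<in> l2" "v \<in> l2" for u v
    by (rule l2_eqI_inner) (use uv A in \<open>simp_all add: adj l2_add l2inner_add_right bop_l2\<close>)
  show "op_adj A (\<lambda>t. c * u t) = (\<lambda>t. c * op_adj A u t)" if u: "u \<in> l2" for u c
    by (rule l2_eqI_inner) (use u A in \<open>simp_all add: adj l2_smul l2inner_smul_right bop_l2\<close>)
qed (use A in \<open>auto simp: op_adj_l2 l2norm_op_adj_le\<close>, simp add: op_adj_def zvec_def)

lemma adj_pair_op_adj: "is_bop A \<Longrightarrow> adj_pair A (op_adj A)"
  by (simp add: adj_pair_def l2inner_op_adj)

text \<open>The source of all adjoint formulas below: it suffices to verify the defining relation,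
  and the \<open>THE\<close> in \<open>op_adj\<close> is not unfolded after this point.\<close>

lemma op_adj_unique:
  assumes "is_bop A" "is_bop B" "adj_pair A B"
  shows "op_adj A = B"
proof
  fix v
  show "op_adj A v = B v"
  proof (cases "v \<in> l2")
    case True
    then show ?thesis using assms
      by (intro l2_eqI_inner) (auto simp: op_adj_l2 bop_l2 adj_pair_def l2inner_op_adj[symmetric])
  next
    case False
    then show ?thesis using assms by (simp add: bop_outside bop_op_adj)
  qed
qed

lemma adj_pair_sym: "adj_pair A B \<Longrightarrow> adj_pair B A"
  unfolding adj_pair_def by (metis l2inner_cnj)

lemma op_adj_adj: "is_bop A \<Longrightarrow> op_adj (op_adj A) = A"
  by (intro op_adj_unique bop_op_adj adj_pair_sym[OF adj_pair_op_adj])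

lemma opnorm_op_adj_le: "is_bop A \<Longrightarrow> opnorm (op_adj A) \<le> opnorm A"
  by (intro opnorm_leI l2norm_op_adj_le opnorm_nonneg)

lemma op_adj_add: "is_bop A \<Longrightarrow> is_bop B \<Longrightarrow> op_adj (op_add A B) = op_add (op_adj A) (op_adj B)"
  by (intro op_adj_unique bop_op_add bop_op_adj)
    (auto simp: adj_pair_def op_add_def l2inner_add_left l2inner_add_right bop_l2 op_adj_l2 l2inner_op_adj)

lemma op_adj_smul: "is_bop A \<Longrightarrow> op_adj (op_smul c A) = op_smul (cnj c) (op_adj A)"
  by (intro op_adj_unique bop_op_smul bop_op_adj)
    (auto simp: adj_pair_def op_smul_def l2inner_smul_left l2inner_smul_right l2inner_op_adj)

lemma op_adj_diff: "is_bop A \<Longrightarrow> is_bop B \<Longrightarrow> op_adj (op_diff A B) = op_diff (op_adj A) (op_adj B)"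
  by (simp add: op_diff_eq op_adj_add op_adj_smul bop_op_smul)

lemma op_adj_comp: "is_bop A \<Longrightarrow> is_bop B \<Longrightarrow> op_adj (A \<circ> B) = op_adj B \<circ> op_adj A"
  by (intro op_adj_unique bop_comp bop_op_adj)
    (auto simp: adj_pair_def bop_l2 op_adj_l2 l2inner_op_adj)

lemma op_adj_mult_op:
  assumes "bdd_above (range (\<lambda>t. cmod (a t)))"
  shows "op_adj (mult_op a) = mult_op (\<lambda>t. cnj (a t))"
  by (intro op_adj_unique bop_mult_op)
    (use assms in \<open>auto simp: adj_pair_def mult_op_def l2inner_def mult_ac\<close>)

lemma op_adj_proj: "op_adj (proj X) = proj X"
  by (intro op_adj_unique bop_proj)
    (auto simp: adj_pair_def proj_apply l2inner_def intro!: infsum_cong)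

lemma op_adj_shift: "op_adj (shift r) = shift (- r)"
proof (intro op_adj_unique bop_shift)
  show "adj_pair (shift r) (shift (- r))"
    unfolding adj_pair_def
  proof (intro ballI)
    fix u v :: "'a vec" assume "u \<in> l2" "v \<in> l2"
    then show "l2inner (shift r u) v = l2inner u (shift (- r) v)"
      using l2inner_translate[of u "-r" "\<lambda>t. v (r + t)"] by (simp add: shift_apply add.assoc[symmetric])
  qed
qed

lemma op_within_adj:
  assumes "is_bop A" "is_bop B" "0 \<le> e" "op_within e A B"
  shows "op_within e (op_adj A) (op_adj B)"
proof -
  have "opnorm (op_diff (op_adj A) (op_adj B)) \<le> opnorm (op_diff A B)"
    using opnorm_op_adj_le[OF bop_op_diff[OF assms(1,2)]] by (simp add: op_adj_diff assms)
  then show ?thesis using assms opnorm_diff_le_iff by (meson bop_op_adj order_trans)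
qed

section \<open>Band-dominated operators and algebras of operator sequences\<close>

lemma proj_at: "u \<in> l2 \<Longrightarrow> proj X u t = (if t \<in> X then u t else 0)"
  by (simp add: proj_def)

lemma shift_at: "u \<in> l2 \<Longrightarrow> shift r u t = u (- r + t)"
  by (simp add: shift_def)

lemma mult_op_at: "u \<in> l2 \<Longrightarrow> mult_op a u t = a t * u t"
  by (simp add: mult_op_def)

lemma proj_Compl: "u \<in> l2 \<Longrightarrow> proj (- X) u = (\<lambda>t. u t - proj X u t)"
  by (auto simp: proj_at)

lemma proj_idem [simp]: "proj X (proj X u) = proj X u"
  by (cases "u \<in> l2") (auto simp: fun_eq_iff proj_at bop_outside)

lemma bop_eqI:
  assumes "is_bop A" "is_bop B" "\<And>u t. u \<in> l2 \<Longrightarrow> A u t = B u t"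
  shows "A = B"
proof
  fix u show "A u = B u"
    using assms by (cases "u \<in> l2") (auto simp: bop_outside)
qed

lemma proj_diff:
  assumes "X \<subseteq> Z"
  shows "proj (Z - X) = op_add (proj Z) (op_smul (-1) (proj X))"
proof (rule bop_eqI)
  fix u :: "'a vec" and t assume u: "u \<in> l2"
  show "proj (Z - X) u t = op_add (proj Z) (op_smul (-1) (proj X)) u t"
    using assms u by (auto simp: op_add_def op_smul_def proj_at)
qed auto

lemma proj_Un:
  "proj (X \<union> Z) = op_add (proj X) (op_add (proj Z) (op_smul (-1) (proj X \<circ> proj Z)))"
proof (rule bop_eqI)
  fix u :: "'a vec" and t assume u: "u \<in> l2"
  show "proj (X \<union> Z) u t = op_add (proj X) (op_add (proj Z) (op_smul (-1) (proj X \<circ> proj Z))) u t"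
    using u by (auto simp: op_add_def op_smul_def proj_at)
qed (intro bop_proj bop_op_add bop_op_smul bop_comp)+

lemma opnorm_op_diff_le:
  assumes "is_bop A" "is_bop B"
  shows "opnorm (op_diff A B) \<le> opnorm A + opnorm B"
proof (rule opnorm_leI)
  fix u :: "'a vec" assume u: "u \<in> l2"
  show "l2norm (op_diff A B u) \<le> (opnorm A + opnorm B) * l2norm u"
    using l2norm_triangle_diff[of "A u" "B u"] opnorm_bound[OF assms(1) u] opnorm_bound[OF assms(2) u] assms u
    by (simp add: op_diff_def bop_l2 algebra_simps)
qed (use assms opnorm_nonneg[of A] opnorm_nonneg[of B] in simp)

text \<open>Replaces convergent sequences by approximation within every \<open>e\<close>, the form
  in which the limit cases of the later inductions are stated; the sequence is recovered from the
  tolerances \<open>1 / real (Suc k)\<close>.\<close>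

lemma op_closedD:
  assumes "op_closed \<A>" "\<And>A. A \<in> \<A> \<Longrightarrow> is_bop A" "is_bop L"
    "\<And>e. 0 < e \<Longrightarrow> \<exists>X\<in>\<A>. op_within e X L"
  shows "L \<in> \<A>"
proof -
  have "\<exists>X\<in>\<A>. op_within (1 / real (Suc k)) X L" for k using assms(4) by simp
  then obtain X where X: "\<And>k. X k \<in> \<A>" "\<And>k. op_within (1 / real (Suc k)) (X k) L" by metis
  have "(\<lambda>k. opnorm (op_diff (X k) L)) \<longlonglongrightarrow> 0"
  proof (rule tendsto_sandwich[where f="\<lambda>_. 0" and h="\<lambda>k. 1 / real (Suc k)"])
    show "(\<lambda>k. 1 / real (Suc k)) \<longlonglongrightarrow> 0" using LIMSEQ_inverse_real_of_nat by (simp add: inverse_eq_divide)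
    show "\<forall>\<^sub>F k in sequentially. 0 \<le> opnorm (op_diff (X k) L)"
      using X(1) assms by (simp add: opnorm_nonneg bop_op_diff)
    show "\<forall>\<^sub>F k in sequentially. opnorm (op_diff (X k) L) \<le> 1 / real (Suc k)"
      using X assms by (simp add: opnorm_diff_le_iff)
  qed auto
  then show ?thesis using assms(1,3) X(1) unfolding op_closed_def by blast
qed

lemma op_closedI:
  assumes "\<And>A. A \<in> \<A> \<Longrightarrow> is_bop A"
    "\<And>L. is_bop L \<Longrightarrow> (\<And>e. 0 < e \<Longrightarrow> \<exists>X\<in>\<A>. op_within e X L) \<Longrightarrow> L \<in> \<A>"
  shows "op_closed \<A>"
  unfolding op_closed_def
proof (intro allI impI)
  fix X L assume X: "\<forall>k. X k \<in> \<A>" and L: "is_bop L" and lim: "(\<lambda>k. opnorm (op_diff (X k) L)) \<longlonglongrightarrow> 0"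
  show "L \<in> \<A>"
  proof (rule assms(2)[OF L])
    fix e :: real assume e: "0 < e"
    obtain k where "opnorm (op_diff (X k) L) < e"
      using order_tendstoD(2)[OF lim e] by (auto simp: eventually_sequentially)
    then have "op_within e (X k) L" using opnorm_diff_le_iff[of "X k" L e] assms(1) X L e by simp
    then show "\<exists>X\<in>\<A>. op_within e X L" using X by blast
  qed
qed

section \<open>The algebra of bounded operator sequences\<close>

lemma FY_bop: "A \<in> FY Y \<Longrightarrow> is_bop (A n)"
  and FY_compress: "A \<in> FY Y \<Longrightarrow> proj (Y n) \<circ> A n \<circ> proj (Y n) = A n"
  by (auto simp: FY_def)

lemma FY_proj_right [simp]: "A \<in> FY Y \<Longrightarrow> A n (proj (Y n) u) = A n u"
  using FY_compress[of A Y n] by (metis comp_apply proj_idem)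

lemma FY_proj_left [simp]: "A \<in> FY Y \<Longrightarrow> proj (Y n) (A n u) = A n u"
  using FY_compress[of A Y n] by (metis comp_apply proj_idem)

text \<open>The bound is made strictly positive because it later serves as a divisor.\<close>

lemma FY_bounded:
  assumes "A \<in> FY Y"
  obtains c where "0 < c" "\<And>n. opnorm (A n) \<le> c"
proof -
  obtain c where "\<And>n. opnorm (A n) \<le> c" using assms by (auto simp: FY_def bdd_above_def)
  then have "\<And>n. opnorm (A n) \<le> max c 1" by (simp add: le_max_iff_disj)
  then show thesis by (rule that[rotated]) simp
qed

lemma FYI:
  assumes "\<And>n. is_bop (A n)" "\<And>n u. u \<in> l2 \<Longrightarrow> A n (proj (Y n) u) = A n u"
    "\<And>n u. u \<in> l2 \<Longrightarrow> proj (Y n) (A n u) = A n u" "\<And>n. opnorm (A n) \<le> c"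
  shows "A \<in> FY Y"
proof -
  have "A n = proj (Y n) \<circ> A n \<circ> proj (Y n)" for n
    by (rule bop_eqI) (use assms in \<open>auto intro!: bop_comp\<close>)
  then show ?thesis using assms(1,4) unfolding FY_def by (auto intro!: bdd_aboveI[of _ c])
qed

lemma FY_add:
  assumes A: "A \<in> FY Y" and B: "B \<in> FY Y"
  shows "seq_add A B \<in> FY Y"
proof -
  obtain c where c: "\<And>n. opnorm (A n) \<le> c" using FY_bounded[OF A] by metis
  obtain d where d: "\<And>n. opnorm (B n) \<le> d" using FY_bounded[OF B] by metis
  note b = FY_bop[OF A] FY_bop[OF B]
  show ?thesis
  proof (rule FYI[where c="c + d"])
    fix n and u :: "'a vec" assume u: "u \<in> l2"
    show "seq_add A B n (proj (Y n) u) = seq_add A B n u"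
      using A B by (simp add: seq_add_def op_add_def)
    show "proj (Y n) (seq_add A B n u) = seq_add A B n u"
      using A B by (simp add: seq_add_def op_add_def bop_add bop_l2[OF b(1) u] bop_l2[OF b(2) u])
  next
    fix n
    show "is_bop (seq_add A B n)" using b by (simp add: seq_add_def bop_op_add)
    have "opnorm (seq_add A B n) \<le> opnorm (A n) + opnorm (B n)"
    proof (rule opnorm_leI)
      fix u :: "'a vec" assume u: "u \<in> l2"
      show "l2norm (seq_add A B n u) \<le> (opnorm (A n) + opnorm (B n)) * l2norm u"
        using l2norm_triangle[OF bop_l2[OF b(1) u] bop_l2[OF b(2) u], of n n]
          opnorm_bound[OF b(1) u, of n] opnorm_bound[OF b(2) u, of n]
        by (simp add: seq_add_def op_add_def algebra_simps)
    qed (use opnorm_nonneg[OF b(1), of n] opnorm_nonneg[OF b(2), of n] in simp)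
    then show "opnorm (seq_add A B n) \<le> c + d" using c[of n] d[of n] by linarith
  qed
qed

lemma FY_smul:
  assumes A: "A \<in> FY Y"
  shows "seq_smul c A \<in> FY Y"
proof -
  obtain d where d: "0 < d" "\<And>n. opnorm (A n) \<le> d" using FY_bounded[OF A] by metis
  note b = FY_bop[OF A]
  show ?thesis
  proof (rule FYI[where c="cmod c * d"])
    fix n and u :: "'a vec" assume u: "u \<in> l2"
    show "seq_smul c A n (proj (Y n) u) = seq_smul c A n u"
      using A by (simp add: seq_smul_def op_smul_def)
    show "proj (Y n) (seq_smul c A n u) = seq_smul c A n u"
      using A by (simp add: seq_smul_def op_smul_def bop_smul bop_l2[OF b u])
  next
    fix n
    show "is_bop (seq_smul c A n)" using b by (simp add: seq_smul_def bop_op_smul)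
    show "opnorm (seq_smul c A n) \<le> cmod c * d"
    proof (rule opnorm_leI)
      fix u :: "'a vec" assume u: "u \<in> l2"
      have "l2norm (A n u) \<le> d * l2norm u"
        using opnorm_le_iff[OF b, of d n] d u by auto
      then show "l2norm (seq_smul c A n u) \<le> cmod c * d * l2norm u"
        by (simp add: seq_smul_def op_smul_def l2norm_smul mult.assoc mult_left_mono)
    qed (use d in auto)
  qed
qed

lemma FY_mul:
  assumes A: "A \<in> FY Y" and B: "B \<in> FY Y"
  shows "seq_mul A B \<in> FY Y"
proof -
  obtain c where c: "\<And>n. opnorm (A n) \<le> c" using FY_bounded[OF A] by metis
  obtain d where d: "\<And>n. opnorm (B n) \<le> d" using FY_bounded[OF B] by metis
  show ?thesis
    by (rule FYI[where c="c * d"])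
      (use A B c d FY_bop[OF A] FY_bop[OF B] in \<open>auto simp: seq_mul_def intro!: opnorm_comp_le bop_comp\<close>)
qed

lemma FY_adj:
  assumes A: "A \<in> FY Y"
  shows "seq_adj A \<in> FY Y"
proof -
  obtain c where c: "\<And>n. opnorm (A n) \<le> c" using FY_bounded[OF A] by metis
  note b = FY_bop[OF A]
  have "op_adj (A n) = proj (Y n) \<circ> op_adj (A n) \<circ> proj (Y n)" for n
    using arg_cong[OF FY_compress[OF A, of n], of op_adj] b
    by (simp add: op_adj_comp op_adj_proj bop_comp comp_assoc)
  moreover have "opnorm (op_adj (A n)) \<le> c" for n
    using opnorm_op_adj_le[OF b, of n] c[of n] by linarith
  ultimately show ?thesis
    using b by (auto simp: FY_def seq_adj_def bop_op_adj intro!: bdd_aboveI[of _ c])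
qed

abbreviation compression :: "(nat \<Rightarrow> 'g set) \<Rightarrow> 'g op \<Rightarrow> 'g opseq" where
  "compression Y A \<equiv> (\<lambda>n. proj (Y n) \<circ> A \<circ> proj (Y n))"

lemma opnorm_compress_le:
  assumes "is_bop A"
  shows "opnorm (proj X \<circ> A \<circ> proj Z) \<le> opnorm A"
proof -
  have "opnorm (proj X \<circ> A \<circ> proj Z) \<le> 1 * opnorm A * 1"
    by (intro opnorm_comp_le bop_comp opnorm_proj_le assms order_refl) auto
  then show ?thesis by simp
qed

lemma FY_compression: "is_bop A \<Longrightarrow> compression Y A \<in> FY Y"
  by (rule FYI[where c="opnorm A"]) (auto intro!: bop_comp opnorm_compress_le)

lemma seq_closedD:
  assumes "seq_closed Y \<A>" "\<A> \<subseteq> FY Y" "L \<in> FY Y"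
    "\<And>e. 0 < e \<Longrightarrow> \<exists>X\<in>\<A>. \<forall>n. op_within e (X n) (L n)"
  shows "L \<in> \<A>"
proof -
  have "\<exists>X\<in>\<A>. \<forall>n. op_within (1 / real (Suc k)) (X n) (L n)" for k using assms(4) by simp
  then obtain X where X: "\<And>k. X k \<in> \<A>" "\<And>k n. op_within (1 / real (Suc k)) (X k n) (L n)" by metis
  have b: "is_bop (X k n)" "is_bop (L n)" for k n using X(1) assms(2,3) FY_bop by blast+
  have le: "opnorm (op_diff (X k n) (L n)) \<le> 1 / real (Suc k)" for k n
    using X(2) b by (simp add: opnorm_diff_le_iff)
  have "(\<lambda>k. seq_dist (X k) L) \<longlonglongrightarrow> 0"
  proof (rule tendsto_sandwich[where f="\<lambda>_. 0" and h="\<lambda>k. 1 / real (Suc k)"])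
    show "(\<lambda>k. 1 / real (Suc k)) \<longlonglongrightarrow> 0" using LIMSEQ_inverse_real_of_nat by (simp add: inverse_eq_divide)
    have "0 \<le> seq_dist (X k) L" for k
    proof -
      have "0 \<le> opnorm (op_diff (X k 0) (L 0))" using b by (intro opnorm_nonneg bop_op_diff)
      also have "\<dots> \<le> seq_dist (X k) L" unfolding seq_dist_def
        by (rule cSup_upper) (auto intro!: bdd_aboveI[of _ "1 / real (Suc k)"] le simp del: of_nat_Suc)
      finally show ?thesis .
    qed
    then show "\<forall>\<^sub>F k in sequentially. 0 \<le> seq_dist (X k) L" by simp
    have "seq_dist (X k) L \<le> 1 / real (Suc k)" for k unfolding seq_dist_def
      by (rule cSup_least) (auto intro!: le simp del: of_nat_Suc)
    then show "\<forall>\<^sub>F k in sequentially. seq_dist (X k) L \<le> 1 / real (Suc k)" by simp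
  qed auto
  then show ?thesis using assms(1,3) X(1) unfolding seq_closed_def by blast
qed

lemma seq_closedI:
  assumes "\<A> \<subseteq> FY Y"
    "\<And>L. L \<in> FY Y \<Longrightarrow> (\<And>e. 0 < e \<Longrightarrow> \<exists>X\<in>\<A>. \<forall>n. op_within e (X n) (L n)) \<Longrightarrow> L \<in> \<A>"
  shows "seq_closed Y \<A>"
  unfolding seq_closed_def
proof (intro allI impI)
  fix X L assume X: "\<forall>k. X k \<in> \<A>" and L: "L \<in> FY Y" and lim: "(\<lambda>k. seq_dist (X k) L) \<longlonglongrightarrow> 0"
  show "L \<in> \<A>"
  proof (rule assms(2)[OF L])
    fix e :: real assume e: "0 < e"
    obtain k where k: "seq_dist (X k) L < e"
      using order_tendstoD(2)[OF lim e] by (auto simp: eventually_sequentially)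
    have XF: "X k \<in> FY Y" using X assms(1) by blast
    obtain c where c: "\<And>n. opnorm (X k n) \<le> c" using FY_bounded[OF XF] by metis
    obtain d where d: "\<And>n. opnorm (L n) \<le> d" using FY_bounded[OF L] by metis
    \<comment> \<open>\<open>seq_dist\<close> is a supremum over \<open>n\<close>, so it dominates
      its individual terms only after their range is known to be bounded.\<close>
    have le: "opnorm (op_diff (X k n) (L n)) \<le> c + d" for n
      using opnorm_op_diff_le[OF FY_bop[OF XF] FY_bop[OF L], of n n] c[of n] d[of n] by linarith
    have "op_within e (X k n) (L n)" for n
    proof -
      have "opnorm (op_diff (X k n) (L n)) \<le> seq_dist (X k) L" unfolding seq_dist_def
        by (rule cSup_upper) (auto intro!: bdd_aboveI[of _ "c + d"] le)
      then show ?thesis using opnorm_diff_le_iff[OF FY_bop[OF XF] FY_bop[OF L], of e n n] k e by simp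
    qed
    then show "\<exists>X\<in>\<A>. \<forall>n. op_within e (X n) (L n)" using X by blast
  qed
qed

section \<open>Least closed algebras and ideals, with their induction rules\<close>

lemma op_closed_Inter: "(\<And>\<A>. \<A> \<in> C \<Longrightarrow> op_closed \<A>) \<Longrightarrow> op_closed (\<Inter>C)"
  unfolding op_closed_def by (meson InterE InterI)

lemma seq_closed_Inter: "(\<And>\<A>. \<A> \<in> C \<Longrightarrow> seq_closed Y \<A>) \<Longrightarrow> seq_closed Y (\<Inter>C)"
  unfolding seq_closed_def by (meson InterE InterI)

text \<open>The set of all bounded operators is itself a member of the family intersected in
  \<open>BDO\<close>.\<close>

lemma BDO_bop: "A \<in> BDO \<Longrightarrow> is_bop A"
proof -
  assume "A \<in> BDO"
  moreover have "BDO \<subseteq> {A :: 'a op. is_bop A}"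
    unfolding BDO_def by (rule Inter_lower) (auto intro!: op_closedI)
  ultimately show ?thesis by blast
qed

lemma BDO_shift: "shift r \<in> BDO"
  and BDO_mult_op: "bdd_above (range (\<lambda>t. cmod (a t))) \<Longrightarrow> mult_op a \<in> BDO"
  and BDO_add: "A \<in> BDO \<Longrightarrow> B \<in> BDO \<Longrightarrow> op_add A B \<in> BDO"
  and BDO_comp: "A \<in> BDO \<Longrightarrow> B \<in> BDO \<Longrightarrow> A \<circ> B \<in> BDO"
  and BDO_smul: "A \<in> BDO \<Longrightarrow> op_smul c A \<in> BDO"
  by (simp_all add: BDO_def)

lemma op_closed_BDO: "op_closed BDO"
  unfolding BDO_def by (rule op_closed_Inter) blast

lemma BDO_limit: "is_bop L \<Longrightarrow> (\<And>e. 0 < e \<Longrightarrow> \<exists>X\<in>BDO. op_within e X L) \<Longrightarrow> L \<in> BDO"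
  by (rule op_closedD[OF op_closed_BDO BDO_bop])

text \<open>The members of \<open>BDO\<close> with property \<open>P\<close> form one of the sets
  intersected in \<open>BDO\<close>. The limit case asks for closure under approximation by
  operators that already have \<open>P\<close>.\<close>

lemma BDO_induct [consumes 1, case_names shift mult add comp smul limit]:
  assumes "A \<in> BDO"
    and "\<And>r. P (shift r)"
    and "\<And>a. bdd_above (range (\<lambda>t. cmod (a t))) \<Longrightarrow> P (mult_op a)"
    and "\<And>A B. A \<in> BDO \<Longrightarrow> B \<in> BDO \<Longrightarrow> P A \<Longrightarrow> P B \<Longrightarrow> P (op_add A B)"
    and "\<And>A B. A \<in> BDO \<Longrightarrow> B \<in> BDO \<Longrightarrow> P A \<Longrightarrow> P B \<Longrightarrow> P (A \<circ> B)"
    and "\<And>c A. A \<in> BDO \<Longrightarrow> P A \<Longrightarrow> P (op_smul c A)"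
    and "\<And>L. L \<in> BDO \<Longrightarrow> (\<And>e. 0 < e \<Longrightarrow> \<exists>X\<in>BDO. P X \<and> op_within e X L) \<Longrightarrow> P L"
  shows "P A"
proof -
  let ?\<A> = "{A \<in> BDO. P A}"
  have "op_closed ?\<A>"
  proof (rule op_closedI)
    fix L :: "'a op" assume L: "is_bop L" "\<And>e. 0 < e \<Longrightarrow> \<exists>X\<in>?\<A>. op_within e X L"
    then have "L \<in> BDO" by (intro BDO_limit) auto
    then show "L \<in> ?\<A>" using assms(7)[of L] L(2) by auto
  qed (auto simp: BDO_bop)
  then have "BDO \<subseteq> ?\<A>"
    by (subst BDO_def, intro Inter_lower)
      (auto simp: BDO_bop BDO_shift BDO_mult_op BDO_add BDO_comp BDO_smul assms(2-6))
  then show ?thesis using assms(1) by blast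
qed

text \<open>\<open>BDO\<close> is generated as a closed algebra, without reference to adjoints.
  Adjoints of shifts and multiplication operators are again of that kind, and taking adjoints
  respects sums, products (reversed) and norm approximation.\<close>

lemma BDO_adj: "A \<in> BDO \<Longrightarrow> op_adj A \<in> BDO"
proof (induction rule: BDO_induct)
  case (limit L)
  show ?case
  proof (rule BDO_limit)
    fix e :: real assume e: "0 < e"
    obtain X where X: "X \<in> BDO" "op_adj X \<in> BDO" "op_within e X L" using limit(2)[OF e] by blast
    then have "op_within e (op_adj X) (op_adj L)"
      using limit(1) e by (intro op_within_adj BDO_bop) auto
    then show "\<exists>X\<in>BDO. op_within e X (op_adj L)" using X by blast
  qed (use limit(1) BDO_bop in blast)
next
  case (comp A B)
  then show ?case by (simp only: op_adj_comp BDO_bop BDO_comp)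
qed (auto simp: op_adj_shift op_adj_mult_op op_adj_add op_adj_smul BDO_bop
    BDO_shift BDO_add BDO_smul intro!: BDO_mult_op)

lemma BDO_proj: "proj X \<in> BDO"
  unfolding proj_eq_mult_op by (rule BDO_mult_op) (auto intro!: bdd_aboveI[of _ 1])

lemma SY_subset_FY: "SY Y \<subseteq> FY Y"
  unfolding SY_def
  by (rule Inter_lower)
    (auto simp: BDO_bop FY_compression FY_add FY_mul FY_smul FY_adj intro!: seq_closedI)

lemma SY_compression: "T \<in> BDO \<Longrightarrow> compression Y T \<in> SY Y"
  and SY_add: "A \<in> SY Y \<Longrightarrow> B \<in> SY Y \<Longrightarrow> seq_add A B \<in> SY Y"
  and SY_mul: "A \<in> SY Y \<Longrightarrow> B \<in> SY Y \<Longrightarrow> seq_mul A B \<in> SY Y"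
  and SY_smul: "A \<in> SY Y \<Longrightarrow> seq_smul c A \<in> SY Y"
  and SY_adj: "A \<in> SY Y \<Longrightarrow> seq_adj A \<in> SY Y"
  by (simp_all add: SY_def)

lemma seq_closed_SY: "seq_closed Y (SY Y)"
  unfolding SY_def by (rule seq_closed_Inter) blast

lemma SY_limit:
  "L \<in> FY Y \<Longrightarrow> (\<And>e. 0 < e \<Longrightarrow> \<exists>X\<in>SY Y. \<forall>n. op_within e (X n) (L n)) \<Longrightarrow> L \<in> SY Y"
  by (rule seq_closedD[OF seq_closed_SY SY_subset_FY])

lemma SY_bop: "A \<in> SY Y \<Longrightarrow> is_bop (A n)"
  using SY_subset_FY FY_bop by blast

lemma SY_induct [consumes 1, case_names compression add mul smul adj limit]:
  assumes "A \<in> SY Y"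
    and "\<And>A. A \<in> BDO \<Longrightarrow> P (compression Y A)"
    and "\<And>A B. A \<in> SY Y \<Longrightarrow> B \<in> SY Y \<Longrightarrow> P A \<Longrightarrow> P B \<Longrightarrow> P (seq_add A B)"
    and "\<And>A B. A \<in> SY Y \<Longrightarrow> B \<in> SY Y \<Longrightarrow> P A \<Longrightarrow> P B \<Longrightarrow> P (seq_mul A B)"
    and "\<And>c A. A \<in> SY Y \<Longrightarrow> P A \<Longrightarrow> P (seq_smul c A)"
    and "\<And>A. A \<in> SY Y \<Longrightarrow> P A \<Longrightarrow> P (seq_adj A)"
    and "\<And>L. L \<in> SY Y \<Longrightarrow>
      (\<And>e. 0 < e \<Longrightarrow> \<exists>X\<in>SY Y. P X \<and> (\<forall>n. op_within e (X n) (L n))) \<Longrightarrow> P L"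
  shows "P A"
proof -
  let ?\<A> = "{A \<in> SY Y. P A}"
  have "seq_closed Y ?\<A>"
  proof (rule seq_closedI)
    fix L assume L: "L \<in> FY Y" "\<And>e. 0 < e \<Longrightarrow> \<exists>X\<in>?\<A>. \<forall>n. op_within e (X n) (L n)"
    then have "L \<in> SY Y" by (intro SY_limit) auto
    then show "L \<in> ?\<A>" using assms(7)[of L] L(2) by auto
  qed (use SY_subset_FY in auto)
  then have "SY Y \<subseteq> ?\<A>"
    by (subst SY_def, intro Inter_lower)
      (use SY_subset_FY in \<open>auto simp: SY_compression SY_add SY_mul SY_smul SY_adj assms(2-6)\<close>)
  then show ?thesis using assms(1) by blast
qed

context
  fixes Y :: "nat \<Rightarrow> 'g::group_add set" and G :: "'g opseq set"
  assumes G: "G \<subseteq> SY Y"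
begin

text \<open>Since the generators lie in \<open>SY Y\<close>, the whole algebra is one of the ideals
  in the intersection.\<close>

lemma ideal_subset: "closed_ideal_gen Y (SY Y) G \<subseteq> SY Y"
  unfolding closed_ideal_gen_def
  by (rule Inter_lower) (use G in \<open>auto simp: SY_add SY_mul SY_smul seq_closed_SY\<close>)

lemma ideal_gen: "A \<in> G \<Longrightarrow> A \<in> closed_ideal_gen Y (SY Y) G"
  and ideal_add: "A \<in> closed_ideal_gen Y (SY Y) G \<Longrightarrow> B \<in> closed_ideal_gen Y (SY Y) G \<Longrightarrow>
    seq_add A B \<in> closed_ideal_gen Y (SY Y) G"
  and ideal_smul: "A \<in> closed_ideal_gen Y (SY Y) G \<Longrightarrow> seq_smul c A \<in> closed_ideal_gen Y (SY Y) G"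
  and ideal_mul_right: "A \<in> closed_ideal_gen Y (SY Y) G \<Longrightarrow> B \<in> SY Y \<Longrightarrow>
    seq_mul A B \<in> closed_ideal_gen Y (SY Y) G"
  and ideal_mul_left: "A \<in> closed_ideal_gen Y (SY Y) G \<Longrightarrow> B \<in> SY Y \<Longrightarrow>
    seq_mul B A \<in> closed_ideal_gen Y (SY Y) G"
  by (auto simp: closed_ideal_gen_def)

lemma seq_closed_ideal: "seq_closed Y (closed_ideal_gen Y (SY Y) G)"
  unfolding closed_ideal_gen_def by (rule seq_closed_Inter) blast

lemma ideal_limit:
  "L \<in> FY Y \<Longrightarrow> (\<And>e. 0 < e \<Longrightarrow> \<exists>X\<in>closed_ideal_gen Y (SY Y) G. \<forall>n. op_within e (X n) (L n)) \<Longrightarrow>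
   L \<in> closed_ideal_gen Y (SY Y) G"
  by (rule seq_closedD[OF seq_closed_ideal]) (use ideal_subset SY_subset_FY in blast)+

lemma ideal_induct [consumes 1, case_names gen add smul mul_right mul_left limit]:
  assumes "A \<in> closed_ideal_gen Y (SY Y) G"
    and "\<And>A. A \<in> G \<Longrightarrow> P A"
    and "\<And>A B. A \<in> closed_ideal_gen Y (SY Y) G \<Longrightarrow> B \<in> closed_ideal_gen Y (SY Y) G \<Longrightarrow>
      P A \<Longrightarrow> P B \<Longrightarrow> P (seq_add A B)"
    and "\<And>c A. A \<in> closed_ideal_gen Y (SY Y) G \<Longrightarrow> P A \<Longrightarrow> P (seq_smul c A)"
    and "\<And>A B. A \<in> closed_ideal_gen Y (SY Y) G \<Longrightarrow> B \<in> SY Y \<Longrightarrow> P A \<Longrightarrow> P (seq_mul A B)"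
    and "\<And>A B. A \<in> closed_ideal_gen Y (SY Y) G \<Longrightarrow> B \<in> SY Y \<Longrightarrow> P A \<Longrightarrow> P (seq_mul B A)"
    and "\<And>L. L \<in> closed_ideal_gen Y (SY Y) G \<Longrightarrow>
      (\<And>e. 0 < e \<Longrightarrow> \<exists>X\<in>closed_ideal_gen Y (SY Y) G. P X \<and> (\<forall>n. op_within e (X n) (L n))) \<Longrightarrow> P L"
  shows "P A"
proof -
  let ?\<A> = "{A \<in> closed_ideal_gen Y (SY Y) G. P A}"
  have "seq_closed Y ?\<A>"
  proof (rule seq_closedI)
    fix L assume L: "L \<in> FY Y" "\<And>e. 0 < e \<Longrightarrow> \<exists>X\<in>?\<A>. \<forall>n. op_within e (X n) (L n)"
    then have "L \<in> closed_ideal_gen Y (SY Y) G" by (intro ideal_limit) auto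
    then show "L \<in> ?\<A>" using assms(7)[of L] L(2) by auto
  qed (use SY_subset_FY ideal_subset in blast)
  then have "closed_ideal_gen Y (SY Y) G \<subseteq> ?\<A>"
    by (subst closed_ideal_gen_def, intro Inter_lower)
      (use ideal_subset in \<open>auto simp: ideal_gen ideal_add ideal_smul ideal_mul_right ideal_mul_left assms(2-6)\<close>)
  then show ?thesis using assms(1) by blast
qed

end

section \<open>Strong convergence\<close>

text \<open>Stands in for the existence of a strong limit; the limit operator is never
  formed.\<close>

definition strongly_cauchy :: "'g opseq \<Rightarrow> bool" where
  "strongly_cauchy A \<longleftrightarrow> (\<forall>u\<in>l2. \<forall>e>0. \<exists>N. \<forall>m\<ge>N. \<forall>n\<ge>N. l2norm (\<lambda>t. A m u t - A n u t) \<le> e)"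

text \<open>The condition in \<open>JY\<close> without its inner projection, which the members of
  \<open>FY Y\<close> absorb.\<close>

definition strongly_null :: "'g opseq \<Rightarrow> bool" where
  "strongly_null A \<longleftrightarrow> (\<forall>u\<in>l2. (\<lambda>n. l2norm (A n u)) \<longlonglongrightarrow> 0)"

lemma strongly_cauchyD:
  assumes "strongly_cauchy A" "u \<in> l2" "0 < e"
  obtains N where "\<And>m n. m \<ge> N \<Longrightarrow> n \<ge> N \<Longrightarrow> l2norm (\<lambda>t. A m u t - A n u t) \<le> e"
  using assms unfolding strongly_cauchy_def by metis

lemma strongly_cauchy_add:
  assumes "\<And>n. is_bop (A n)" "\<And>n. is_bop (B n)" "strongly_cauchy A" "strongly_cauchy B"
  shows "strongly_cauchy (seq_add A B)"
  unfolding strongly_cauchy_def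
proof (intro ballI allI impI)
  fix u :: "'a vec" and e :: real assume u: "u \<in> l2" and e: "0 < e"
  obtain M where M: "\<And>m n. m \<ge> M \<Longrightarrow> n \<ge> M \<Longrightarrow> l2norm (\<lambda>t. A m u t - A n u t) \<le> e/2"
    using strongly_cauchyD[OF assms(3) u, of "e/2"] e by auto
  obtain N where N: "\<And>m n. m \<ge> N \<Longrightarrow> n \<ge> N \<Longrightarrow> l2norm (\<lambda>t. B m u t - B n u t) \<le> e/2"
    using strongly_cauchyD[OF assms(4) u, of "e/2"] e by auto
  show "\<exists>N. \<forall>m\<ge>N. \<forall>n\<ge>N. l2norm (\<lambda>t. seq_add A B m u t - seq_add A B n u t) \<le> e"
  proof (intro exI allI impI)
    fix m n assume mn: "m \<ge> max M N" "n \<ge> max M N"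
    have "l2norm (\<lambda>t. (A m u t - A n u t) + (B m u t - B n u t))
        \<le> l2norm (\<lambda>t. A m u t - A n u t) + l2norm (\<lambda>t. B m u t - B n u t)"
      by (intro l2norm_triangle l2_diff bop_l2[OF assms(1) u] bop_l2[OF assms(2) u])
    also have "\<dots> \<le> e" using M[of m n] N[of m n] mn by simp
    finally show "l2norm (\<lambda>t. seq_add A B m u t - seq_add A B n u t) \<le> e"
      by (simp add: seq_add_def op_add_def algebra_simps)
  qed
qed

lemma strongly_cauchy_smul:
  assumes "strongly_cauchy A"
  shows "strongly_cauchy (seq_smul c A)"
  unfolding strongly_cauchy_def
proof (intro ballI allI impI)
  fix u :: "'a vec" and e :: real assume u: "u \<in> l2" and e: "0 < e"
  have pos: "0 < cmod c + 1" by (simp add: add_nonneg_pos)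
  obtain N where N: "\<And>m n. m \<ge> N \<Longrightarrow> n \<ge> N \<Longrightarrow> l2norm (\<lambda>t. A m u t - A n u t) \<le> e / (cmod c + 1)"
    using strongly_cauchyD[OF assms u, of "e / (cmod c + 1)"] e pos by auto
  show "\<exists>N. \<forall>m\<ge>N. \<forall>n\<ge>N. l2norm (\<lambda>t. seq_smul c A m u t - seq_smul c A n u t) \<le> e"
  proof (intro exI allI impI)
    fix m n assume mn: "m \<ge> N" "n \<ge> N"
    have "l2norm (\<lambda>t. seq_smul c A m u t - seq_smul c A n u t) = l2norm (\<lambda>t. c * (A m u t - A n u t))"
      by (simp add: seq_smul_def op_smul_def algebra_simps)
    also have "\<dots> = cmod c * l2norm (\<lambda>t. A m u t - A n u t)" by (rule l2norm_smul)
    also have "\<dots> \<le> cmod c * (e / (cmod c + 1))" by (intro mult_left_mono N mn) auto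
    also have "\<dots> \<le> e" using e pos by (simp add: field_simps)
    finally show "l2norm (\<lambda>t. seq_smul c A m u t - seq_smul c A n u t) \<le> e" .
  qed
qed

lemma bounded_apply_diff:
  assumes "is_bop A" "opnorm A \<le> c" "u \<in> l2" "v \<in> l2"
  shows "l2norm (\<lambda>t. A u t - A v t) \<le> c * l2norm (\<lambda>t. u t - v t)"
  using opnorm_bound[OF assms(1) l2_diff[OF assms(3,4)]] bop_diff[OF assms(1,3,4)]
    mult_right_mono[OF assms(2) l2norm_nonneg[of "\<lambda>t. u t - v t"]] by simp

text \<open>Freeze the inner vector at \<open>B N u\<close>: the uniform bound on \<open>A\<close>
  pays for the replacement at both indices, and strong convergence of \<open>A\<close> is then
  needed at this single vector, which is why \<open>M\<close> is chosen after
  \<open>N\<close>.\<close>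

lemma strongly_cauchy_mul:
  assumes A: "A \<in> FY Y" "strongly_cauchy A" and B: "B \<in> FY Y" "strongly_cauchy B"
  shows "strongly_cauchy (seq_mul A B)"
  unfolding strongly_cauchy_def
proof (intro ballI allI impI)
  fix u :: "'a vec" and e :: real assume u: "u \<in> l2" and e: "0 < e"
  obtain c where c: "0 < c" "\<And>n. opnorm (A n) \<le> c" using FY_bounded[OF A(1)] by metis
  note l2 = bop_l2[OF FY_bop[OF B(1)] u] bop_l2[OF FY_bop[OF A(1)]]
  obtain N where N: "\<And>m n. m \<ge> N \<Longrightarrow> n \<ge> N \<Longrightarrow> l2norm (\<lambda>t. B m u t - B n u t) \<le> e / (3 * c)"
    using strongly_cauchyD[OF B(2) u, of "e / (3 * c)"] e c(1) by auto
  obtain M where M: "\<And>m n. m \<ge> M \<Longrightarrow> n \<ge> M \<Longrightarrow> l2norm (\<lambda>t. A m (B N u) t - A n (B N u) t) \<le> e / 3"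
    using strongly_cauchyD[OF A(2) l2(1), of "e / 3" N] e by auto
  have near: "l2norm (\<lambda>t. A k (B k u) t - A k (B N u) t) \<le> e / 3" if "k \<ge> N" for k
  proof -
    have "l2norm (\<lambda>t. A k (B k u) t - A k (B N u) t) \<le> c * l2norm (\<lambda>t. B k u t - B N u t)"
      by (intro bounded_apply_diff FY_bop[OF A(1)] c l2)
    also have "\<dots> \<le> c * (e / (3 * c))" using c(1) that by (intro mult_left_mono N) auto
    finally show ?thesis using c(1) by simp
  qed
  show "\<exists>N. \<forall>m\<ge>N. \<forall>n\<ge>N. l2norm (\<lambda>t. seq_mul A B m u t - seq_mul A B n u t) \<le> e"
  proof (intro exI allI impI)
    fix m n assume mn: "m \<ge> max M N" "n \<ge> max M N"
    have "l2norm (\<lambda>t. A m (B m u) t - A n (B n u) t)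
       \<le> l2norm (\<lambda>t. A m (B m u) t - A m (B N u) t) + l2norm (\<lambda>t. A m (B N u) t - A n (B n u) t)"
      by (intro l2norm_diff_trans l2)
    moreover have "l2norm (\<lambda>t. A m (B N u) t - A n (B n u) t)
       \<le> l2norm (\<lambda>t. A m (B N u) t - A n (B N u) t) + l2norm (\<lambda>t. A n (B N u) t - A n (B n u) t)"
      by (intro l2norm_diff_trans l2)
    moreover have "l2norm (\<lambda>t. A n (B N u) t - A n (B n u) t) \<le> e / 3"
      using near[of n] mn by (subst l2norm_minus_commute) simp
    ultimately show "l2norm (\<lambda>t. seq_mul A B m u t - seq_mul A B n u t) \<le> e"
      using near[of m] M[of m n] mn by (simp add: seq_mul_def)
  qed
qed

lemma strongly_cauchy_limit:
  assumes L: "\<And>n. is_bop (L n)"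
    and X: "\<And>e. 0 < e \<Longrightarrow> \<exists>X. (\<forall>n. is_bop (X n)) \<and> strongly_cauchy X \<and> (\<forall>n. op_within e (X n) (L n))"
  shows "strongly_cauchy L"
  unfolding strongly_cauchy_def
proof (intro ballI allI impI)
  fix u :: "'a vec" and e :: real assume u: "u \<in> l2" and e: "0 < e"
  \<comment> \<open>The added 1 keeps the divisor positive when \<open>u\<close> is zero.\<close>
  define d where "d = e / (3 * (l2norm u + 1))"
  have pos: "0 < l2norm u + 1" using l2norm_nonneg[of u] by linarith
  have d: "0 < d" "d * l2norm u \<le> e / 3" using e pos by (auto simp: d_def field_simps)
  obtain X where X: "\<And>n. is_bop (X n)" "strongly_cauchy X" "\<And>n. op_within d (X n) (L n)"
    using X[OF d(1)] by blast
  obtain N where N: "\<And>m n. m \<ge> N \<Longrightarrow> n \<ge> N \<Longrightarrow> l2norm (\<lambda>t. X m u t - X n u t) \<le> e / 3"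
    using strongly_cauchyD[OF X(2) u, of "e / 3"] e by auto
  note l2 = bop_l2[OF L u] bop_l2[OF X(1) u]
  have near: "l2norm (\<lambda>t. X k u t - L k u t) \<le> e / 3" for k
    using X(3)[of k] u d(2) by (force simp: op_within_def)
  show "\<exists>N. \<forall>m\<ge>N. \<forall>n\<ge>N. l2norm (\<lambda>t. L m u t - L n u t) \<le> e"
  proof (intro exI allI impI)
    fix m n assume mn: "m \<ge> N" "n \<ge> N"
    have "l2norm (\<lambda>t. L m u t - L n u t) \<le> l2norm (\<lambda>t. L m u t - X m u t) + l2norm (\<lambda>t. X m u t - L n u t)"
      by (intro l2norm_diff_trans l2)
    moreover have "l2norm (\<lambda>t. X m u t - L n u t) \<le> l2norm (\<lambda>t. X m u t - X n u t) + l2norm (\<lambda>t. X n u t - L n u t)"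
      by (intro l2norm_diff_trans l2)
    moreover have "l2norm (\<lambda>t. L m u t - X m u t) \<le> e / 3"
      using near[of m] by (subst l2norm_minus_commute)
    ultimately show "l2norm (\<lambda>t. L m u t - L n u t) \<le> e"
      using near[of n] N[OF mn] by linarith
  qed
qed

lemma strongly_nullI:
  assumes "\<And>u e. u \<in> l2 \<Longrightarrow> 0 < e \<Longrightarrow> \<exists>N. \<forall>n\<ge>N. l2norm (A n u) \<le> e"
  shows "strongly_null A"
  unfolding strongly_null_def
proof (intro ballI LIMSEQ_I)
  fix u :: "'a vec" and e :: real assume u: "u \<in> l2" and e: "0 < e"
  obtain N where "\<forall>n\<ge>N. l2norm (A n u) \<le> e / 2" using assms[OF u, of "e / 2"] e by auto
  then have "\<forall>n\<ge>N. norm (l2norm (A n u) - 0) < e" using e by (auto intro: le_less_trans)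
  then show "\<exists>N. \<forall>n\<ge>N. norm (l2norm (A n u) - 0) < e" ..
qed

lemma strongly_nullD:
  assumes "strongly_null A" "u \<in> l2" "0 < e"
  obtains N where "\<And>n. n \<ge> N \<Longrightarrow> l2norm (A n u) < e"
  using LIMSEQ_D[of "\<lambda>n. l2norm (A n u)" 0 e] assms unfolding strongly_null_def by auto

lemma seq_adj_add: "A \<in> FY Y \<Longrightarrow> B \<in> FY Y \<Longrightarrow> seq_adj (seq_add A B) = seq_add (seq_adj A) (seq_adj B)"
  by (simp add: seq_adj_def seq_add_def op_adj_add FY_bop)

lemma seq_adj_smul: "A \<in> FY Y \<Longrightarrow> seq_adj (seq_smul c A) = seq_smul (cnj c) (seq_adj A)"
  by (simp add: seq_adj_def seq_smul_def op_adj_smul FY_bop)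

lemma seq_adj_mul: "A \<in> FY Y \<Longrightarrow> B \<in> FY Y \<Longrightarrow> seq_adj (seq_mul A B) = seq_mul (seq_adj B) (seq_adj A)"
  by (simp add: seq_adj_def seq_mul_def op_adj_comp FY_bop)

lemma seq_adj_adj: "A \<in> FY Y \<Longrightarrow> seq_adj (seq_adj A) = A"
  by (simp add: seq_adj_def op_adj_adj FY_bop)

lemma seq_adj_compression: "is_bop T \<Longrightarrow> seq_adj (compression Y T) = compression Y (op_adj T)"
  by (simp add: seq_adj_def op_adj_comp op_adj_proj bop_comp comp_assoc)

section \<open>Exhaustions and strong convergence of the sequences in \<open>SY Y\<close>\<close>

locale exhaustion =
  fixes \<Omega> :: "'g::group_add set" and Y :: "nat \<Rightarrow> 'g set"
  assumes finite_Omega: "finite \<Omega>" and sgrp_gen_Omega: "sgrp_gen \<Omega> = UNIV"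
    and Union_Y: "(\<Union>n. Y n) = UNIV"
    and Y_int: "\<And>n. Y n \<subseteq> int_Om \<Omega> (Y (Suc n))"
begin

abbreviation bdry_seq :: "'g opseq" where
  "bdry_seq \<equiv> (\<lambda>n. proj (bdry_Om \<Omega> (Y n)))"

abbreviation bdry_ideal :: "'g opseq set" where
  "bdry_ideal \<equiv> closed_ideal_gen Y (SY Y) {bdry_seq}"

lemma mono_Y: "mono Y"
  by (rule mono_iff_le_Suc[THEN iffD2]) (use Y_int in \<open>force simp: int_Om_def\<close>)

lemma finite_subset_Y:
  assumes "finite F"
  obtains N where "\<And>n. n \<ge> N \<Longrightarrow> F \<subseteq> Y n"
proof -
  have "\<exists>N. F \<subseteq> Y N" using assms
  proof induction
    case (insert x F)
    obtain N where N: "F \<subseteq> Y N" using insert by blast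
    obtain M where M: "x \<in> Y M" using Union_Y by blast
    have "insert x F \<subseteq> Y (max M N)"
      using N M monoD[OF mono_Y, of M "max M N"] monoD[OF mono_Y, of N "max M N"] by auto
    then show ?case by blast
  qed auto
  then show thesis using that mono_Y by (meson monoD order_trans)
qed

text \<open>As soon as \<open>Y n\<close> contains the finite set \<open>F\<close>, the error is
  dominated pointwise by the tail of \<open>u\<close> outside \<open>F\<close>.\<close>

lemma proj_Y_tendsto:
  assumes u: "u \<in> l2"
  shows "(\<lambda>n. l2norm (\<lambda>t. proj (Y n) u t - u t)) \<longlonglongrightarrow> 0"
proof (rule LIMSEQ_I)
  fix e :: real assume "0 < e"
  then obtain F where F: "finite F" "l2norm (\<lambda>t. if t \<in> F then 0 else u t) < e"
    using l2_tail[OF u] by blast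
  obtain N where N: "\<And>n. n \<ge> N \<Longrightarrow> F \<subseteq> Y n" using finite_subset_Y[OF F(1)] by blast
  have s: "(\<lambda>t. if t \<in> F then 0 else u t) \<in> l2" by (rule l2_dominated[OF u, of _ 1]) auto
  have "l2norm (\<lambda>t. proj (Y n) u t - u t) < e" if "n \<ge> N" for n
  proof -
    have "cmod (proj (Y n) u t - u t) \<le> 1 * cmod (if t \<in> F then 0 else u t)" for t
      using N[OF that] by (auto simp: proj_at[OF u])
    then show ?thesis using l2norm_dominated[OF s, of "\<lambda>t. proj (Y n) u t - u t" 1] F(2) by simp
  qed
  then show "\<exists>N. \<forall>n\<ge>N. norm (l2norm (\<lambda>t. proj (Y n) u t - u t) - 0) < e" by auto
qed

text \<open>Every finite set eventually lies in the interiors, hence off the boundaries, so that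
  only a tail of \<open>u\<close> is seen by the projections.\<close>

lemma strongly_null_bdry_seq: "strongly_null bdry_seq"
  unfolding strongly_null_def
proof (intro ballI LIMSEQ_I)
  fix u :: "'g vec" and e :: real assume u: "u \<in> l2" and "0 < e"
  then obtain F where F: "finite F" "l2norm (\<lambda>t. if t \<in> F then 0 else u t) < e"
    using l2_tail[OF u] by blast
  obtain N where N: "\<And>n. n \<ge> N \<Longrightarrow> F \<subseteq> Y n" using finite_subset_Y[OF F(1)] by blast
  have s: "(\<lambda>t. if t \<in> F then 0 else u t) \<in> l2" by (rule l2_dominated[OF u, of _ 1]) auto
  \<comment> \<open>The index is shifted by one because \<open>F \<subseteq> Y m\<close> keeps
    \<open>F\<close> off the boundary of \<open>Y (Suc m)\<close>, not of
    \<open>Y m\<close>.\<close>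
  have "l2norm (bdry_seq n u) < e" if n: "n \<ge> Suc N" for n
  proof -
    obtain m where m: "n = Suc m" "m \<ge> N" using n by (cases n) auto
    have "F \<inter> bdry_Om \<Omega> (Y n) = {}" using N[OF m(2)] Y_int[of m] unfolding m(1) bdry_Om_def by blast
    then have "cmod (bdry_seq n u t) \<le> 1 * cmod (if t \<in> F then 0 else u t)" for t
      unfolding proj_at[OF u] by auto
    then show ?thesis using l2norm_dominated[OF s, of "bdry_seq n u" 1] F(2) by simp
  qed
  then show "\<exists>N. \<forall>n\<ge>N. norm (l2norm (bdry_seq n u) - 0) < e" by auto
qed

text \<open>With \<open>P\<close> for \<open>proj (Y n)\<close>, the error splits as P (T (P u - u))
  + (P (T u) - T u), and \<open>proj_Y_tendsto\<close> applies to \<open>u\<close> and to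
  \<open>T u\<close>.\<close>

lemma compression_tendsto:
  assumes T: "is_bop T" and u: "u \<in> l2"
  shows "(\<lambda>n. l2norm (\<lambda>t. compression Y T n u t - T u t)) \<longlonglongrightarrow> 0"
proof (rule tendsto_sandwich)
  let ?b = "\<lambda>n. opnorm T * l2norm (\<lambda>t. proj (Y n) u t - u t) + l2norm (\<lambda>t. proj (Y n) (T u) t - T u t)"
  show "\<forall>\<^sub>F n in sequentially. 0 \<le> l2norm (\<lambda>t. compression Y T n u t - T u t)" by simp
  show "?b \<longlonglongrightarrow> 0"
    using tendsto_add[OF tendsto_mult_left[OF proj_Y_tendsto[OF u], of "opnorm T"]
        proj_Y_tendsto[OF bop_l2[OF T u]]] by simp
  show "\<forall>\<^sub>F n in sequentially. l2norm (\<lambda>t. compression Y T n u t - T u t) \<le> ?b n"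
  proof (rule always_eventually, rule allI)
    fix n
    have "l2norm (\<lambda>t. proj (Y n) (T (proj (Y n) u)) t - proj (Y n) (T u) t)
        \<le> 1 * l2norm (\<lambda>t. T (proj (Y n) u) t - T u t)"
      by (intro bounded_apply_diff opnorm_proj_le bop_proj bop_l2[OF T] proj_l2 u)
    moreover have "l2norm (\<lambda>t. T (proj (Y n) u) t - T u t) \<le> opnorm T * l2norm (\<lambda>t. proj (Y n) u t - u t)"
      by (intro bounded_apply_diff T proj_l2 u order_refl)
    moreover have "l2norm (\<lambda>t. compression Y T n u t - T u t)
      \<le> l2norm (\<lambda>t. proj (Y n) (T (proj (Y n) u)) t - proj (Y n) (T u) t)
        + l2norm (\<lambda>t. proj (Y n) (T u) t - T u t)"
      unfolding o_apply by (intro l2norm_diff_trans bop_l2[OF T] proj_l2 u)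
    ultimately show "l2norm (\<lambda>t. compression Y T n u t - T u t) \<le> ?b n" by linarith
  qed
qed auto

lemma strongly_cauchy_compression:
  assumes T: "is_bop T"
  shows "strongly_cauchy (compression Y T)"
  unfolding strongly_cauchy_def
proof (intro ballI allI impI)
  fix u :: "'g vec" and e :: real assume u: "u \<in> l2" and e: "0 < e"
  obtain N where N: "\<And>n. n \<ge> N \<Longrightarrow> l2norm (\<lambda>t. compression Y T n u t - T u t) < e / 2"
    using LIMSEQ_D[OF compression_tendsto[OF T u], of "e / 2"] e by auto
  show "\<exists>N. \<forall>m\<ge>N. \<forall>n\<ge>N. l2norm (\<lambda>t. compression Y T m u t - compression Y T n u t) \<le> e"
  proof (intro exI allI impI)
    fix m n assume mn: "m \<ge> N" "n \<ge> N"
    have "l2norm (\<lambda>t. compression Y T m u t - compression Y T n u t)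
       \<le> l2norm (\<lambda>t. compression Y T m u t - T u t) + l2norm (\<lambda>t. T u t - compression Y T n u t)"
      by (intro l2norm_diff_trans) (auto simp: bop_l2[OF T] u)
    moreover have "l2norm (\<lambda>t. T u t - compression Y T n u t) \<le> e / 2"
      using N[OF mn(2)] by (subst l2norm_minus_commute) simp
    ultimately show "l2norm (\<lambda>t. compression Y T m u t - compression Y T n u t) \<le> e"
      using N[OF mn(1)] by linarith
  qed
qed

lemma SY_FY: "A \<in> SY Y \<Longrightarrow> A \<in> FY Y"
  using SY_subset_FY by blast

text \<open>Strong convergence does not pass to adjoints in general, so the \<open>adj\<close> case
  could not be closed for \<open>A\<close> alone. With the statement for \<open>A\<close> and
  \<open>seq_adj A\<close> together, that case merely swaps the two.\<close>

lemma SY_strongly_cauchy: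
  assumes "A \<in> SY Y"
  shows "strongly_cauchy A"
proof -
  from assms have "strongly_cauchy A \<and> strongly_cauchy (seq_adj A)"
  proof (induction rule: SY_induct)
    case (compression T)
    then show ?case using BDO_bop[OF compression]
      by (simp only: seq_adj_compression strongly_cauchy_compression bop_op_adj)
  next
    case (add A B)
    then show ?case
      unfolding seq_adj_add[OF SY_FY[OF add(1)] SY_FY[OF add(2)]]
      by (auto intro!: strongly_cauchy_add elim: SY_bop SY_bop[OF SY_adj])
  next
    case (mul A B)
    then show ?case
      by (simp add: seq_adj_mul[OF SY_FY SY_FY] strongly_cauchy_mul[OF SY_FY _ SY_FY] SY_adj)
  next
    case (smul c A)
    then show ?case by (simp add: seq_adj_smul[OF SY_FY] strongly_cauchy_smul)
  next
    case (adj A)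
    then show ?case by (simp add: seq_adj_adj[OF SY_FY])
  next
    case (limit L)
    show ?case
    proof
      show "strongly_cauchy L" using limit by (intro strongly_cauchy_limit) (auto intro: SY_bop, meson SY_bop)
      show "strongly_cauchy (seq_adj L)"
      proof (rule strongly_cauchy_limit)
        show "is_bop (seq_adj L n)" for n using limit(1) SY_adj SY_bop by blast
        fix e :: real assume e: "0 < e"
        obtain X where X: "X \<in> SY Y" "strongly_cauchy (seq_adj X)" "\<And>n. op_within e (X n) (L n)"
          using limit(2)[OF e] by blast
        have "op_within e (seq_adj X n) (seq_adj L n)" for n
          unfolding seq_adj_def using e X limit(1) by (intro op_within_adj) (auto intro: SY_bop)
        then show "\<exists>X. (\<forall>n. is_bop (X n)) \<and> strongly_cauchy X \<and> (\<forall>n. op_within e (X n) (seq_adj L n))"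
          using X SY_adj SY_bop by blast
      qed
    qed
  qed
  then show ?thesis ..
qed

end

section \<open>The boundary ideal\<close>

context exhaustion
begin

section \<open>Projections in the algebra and in the boundary ideal\<close>

lemma SY_proj_Y: "(\<lambda>n. proj (Y n)) \<in> SY Y"
  \<comment> \<open>\<open>proj UNIV\<close> is the identity, normalised to vanish outside
    \<open>l2\<close>.\<close>
  using SY_compression[OF BDO_proj[of UNIV], of Y] by (simp add: proj_comp)

lemma SY_proj_diff:
  assumes "(\<lambda>n. proj (Z n)) \<in> SY Y" "\<And>n. Z n \<subseteq> Y n"
  shows "(\<lambda>n. proj (Y n - Z n)) \<in> SY Y"
  using SY_add[OF SY_proj_Y SY_smul[OF assms(1), of "-1"]]
  by (simp add: seq_add_def seq_smul_def proj_diff assms(2))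

text \<open>Conjugating a projection by a shift translates its set. Since \<open>Z n\<close> lies in
  \<open>Y n\<close>, the inner compressions cut nothing off, and the outer ones only restrict to
  \<open>Y n\<close>.\<close>

lemma proj_translate:
  assumes "\<And>n. Z n \<subseteq> Y n"
  shows "seq_mul (compression Y (shift (- r))) (seq_mul (\<lambda>n. proj (Z n)) (compression Y (shift r)))
    = (\<lambda>n. proj {s \<in> Y n. r + s \<in> Z n})"
proof
  fix n
  show "seq_mul (compression Y (shift (- r))) (seq_mul (\<lambda>n. proj (Z n)) (compression Y (shift r))) n
     = proj {s \<in> Y n. r + s \<in> Z n}"
  proof (rule bop_eqI)
    fix u :: "'g vec" and t assume u: "u \<in> l2"
    show "seq_mul (compression Y (shift (- r))) (seq_mul (\<lambda>n. proj (Z n)) (compression Y (shift r))) n u t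
      = proj {s \<in> Y n. r + s \<in> Z n} u t"
      using assms[of n] u by (auto simp: seq_mul_def proj_at shift_at bop_l2 add.assoc[symmetric])
  qed (auto simp: seq_mul_def intro!: bop_comp)
qed

lemma SY_proj_return: "(\<lambda>n. proj {s \<in> Y n. r + s \<in> Y n}) \<in> SY Y"
  using SY_mul[OF SY_compression[OF BDO_shift[of "- r"]] SY_mul[OF SY_proj_Y SY_compression[OF BDO_shift[of r]]]]
  by (subst proj_translate[of Y r, symmetric]) simp_all

lemma SY_proj_mul:
  assumes "(\<lambda>n. proj (X n)) \<in> SY Y" "(\<lambda>n. proj (Z n)) \<in> SY Y"
  shows "(\<lambda>n. proj (X n \<inter> Z n)) \<in> SY Y"
  using SY_mul[OF assms] by (simp add: seq_mul_def proj_comp)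

text \<open>The interior is the intersection, over the finite set \<open>\<Omega>\<close>, of the
  sets of points that one generator keeps inside; their projections are in the algebra, and so are
  finite products and complements relative to \<open>Y n\<close>.\<close>

lemma SY_bdry_seq: "bdry_seq \<in> SY Y"
proof -
  have "(\<lambda>n. proj {s \<in> Y n. \<forall>\<omega>\<in>F. \<omega> + s \<in> Y n}) \<in> SY Y" if "finite F" for F
    using that
  proof induction
    case empty
    then show ?case using SY_proj_Y by simp
  next
    case (insert x F)
    have "{s \<in> Y n. x + s \<in> Y n} \<inter> {s \<in> Y n. \<forall>\<omega>\<in>F. \<omega> + s \<in> Y n} = {s \<in> Y n. \<forall>\<omega>\<in>insert x F. \<omega> + s \<in> Y n}" for n
      by auto
    then show ?case using SY_proj_mul[OF SY_proj_return[of x] insert.IH] by simp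
  qed
  from this[OF finite_Omega] show ?thesis
    unfolding bdry_Om_def by (intro SY_proj_diff) (auto simp: int_Om_def)
qed

lemma bdry_gen: "{bdry_seq} \<subseteq> SY Y" using SY_bdry_seq by simp

lemmas bdry_ideal_subset = ideal_subset[OF bdry_gen]
  and bdry_ideal_gen = ideal_gen[OF bdry_gen, of bdry_seq, simplified]
  and bdry_ideal_add = ideal_add[OF bdry_gen]
  and bdry_ideal_smul = ideal_smul[OF bdry_gen]
  and bdry_ideal_mul_right = ideal_mul_right[OF bdry_gen]
  and bdry_ideal_mul_left = ideal_mul_left[OF bdry_gen]
  and bdry_ideal_limit = ideal_limit[OF bdry_gen]
  and bdry_ideal_induct = ideal_induct[OF bdry_gen, consumes 1, case_names gen add smul mul_right mul_left limit]

lemma bdry_ideal_SY: "A \<in> bdry_ideal \<Longrightarrow> A \<in> SY Y"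
  using bdry_ideal_subset by blast

lemma bdry_ideal_FY: "A \<in> bdry_ideal \<Longrightarrow> A \<in> FY Y"
  using bdry_ideal_SY SY_FY by blast

text \<open>The smaller projection equals its product with the larger one, so the ideal absorbs it
  once it is known to lie in \<open>SY Y\<close>.\<close>

lemma bdry_ideal_proj_subset:
  assumes "(\<lambda>n. proj (Z n)) \<in> bdry_ideal" "(\<lambda>n. proj (X n)) \<in> SY Y" "\<And>n. X n \<subseteq> Z n"
  shows "(\<lambda>n. proj (X n)) \<in> bdry_ideal"
proof -
  have "Z n \<inter> X n = X n" for n using assms(3) by blast
  then show ?thesis using bdry_ideal_mul_right[OF assms(1,2)] by (simp add: seq_mul_def proj_comp)
qed

text \<open>Inclusion-exclusion for commuting projections.\<close>

lemma bdry_ideal_proj_Un: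
  assumes "(\<lambda>n. proj (X n)) \<in> bdry_ideal" "(\<lambda>n. proj (Z n)) \<in> bdry_ideal"
  shows "(\<lambda>n. proj (X n \<union> Z n)) \<in> bdry_ideal"
  using bdry_ideal_add[OF assms(1) bdry_ideal_add[OF assms(2)
        bdry_ideal_smul[OF bdry_ideal_mul_right[OF assms(1) bdry_ideal_SY[OF assms(2)]], of "-1"]]]
  by (simp only: proj_Un seq_add_def seq_smul_def seq_mul_def)

lemma SY_proj_leave: "(\<lambda>n. proj {s \<in> Y n. r + s \<notin> Y n}) \<in> SY Y"
proof -
  have "Y n - {s \<in> Y n. r + s \<in> Y n} = {s \<in> Y n. r + s \<notin> Y n}" for n by auto
  then show ?thesis using SY_proj_diff[OF SY_proj_return[of r]] by simp
qed

text \<open>A word in the generators that leads from inside \<open>Y n\<close> to outside must cross the boundary.\<close>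

lemma bdry_ideal_proj_leave: "(\<lambda>n. proj {s \<in> Y n. r + s \<notin> Y n}) \<in> bdry_ideal"
proof -
  have gen: "(\<lambda>n. proj {s \<in> Y n. \<omega> + s \<notin> Y n}) \<in> bdry_ideal" if "\<omega> \<in> \<Omega>" for \<omega>
    by (rule bdry_ideal_proj_subset[OF bdry_ideal_gen SY_proj_leave])
      (use that in \<open>auto simp: bdry_Om_def int_Om_def\<close>)
  have "r \<in> sgrp_gen \<Omega>" using sgrp_gen_Omega by simp
  then show ?thesis
  proof induction
    case (base \<omega>)
    then show ?case by (rule gen)
  next
    case (step \<omega> x)
    \<comment> \<open>Points that \<open>x\<close> keeps inside and from which the last letter
      \<open>\<omega>\<close> leads out: the projection for \<open>\<omega>\<close>, conjugated by
      the shift for \<open>x\<close>.\<close>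
    have "(\<lambda>n. proj {s \<in> Y n. x + s \<in> {s \<in> Y n. \<omega> + s \<notin> Y n}}) \<in> bdry_ideal"
      by (subst proj_translate[symmetric], blast)
        (intro bdry_ideal_mul_left bdry_ideal_mul_right gen step SY_compression BDO_shift)
    \<comment> \<open>If \<open>\<omega> + x + s\<close> is outside, then either
      \<open>x + s\<close> is outside already or \<open>\<omega>\<close> leads out from it.\<close>
    from bdry_ideal_proj_Un[OF step.IH this] show ?case
      by (rule bdry_ideal_proj_subset[OF _ SY_proj_leave]) (auto simp: add.assoc)
  qed
qed

section \<open>Semi-commutators of compressions\<close>

definition semi_commutator :: "'g op \<Rightarrow> 'g op \<Rightarrow> 'g opseq" where
  "semi_commutator S T = (\<lambda>n. proj (Y n) \<circ> S \<circ> proj (- Y n) \<circ> T \<circ> proj (Y n))"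

lemma bop_semi_commutator: "is_bop S \<Longrightarrow> is_bop T \<Longrightarrow> is_bop (semi_commutator S T n)"
  by (auto simp: semi_commutator_def intro!: bop_comp)

text \<open>The definition, a product through the complement, displays boundedness and vanishing;
  this difference form is the one suited to algebraic identities.\<close>

lemma semi_commutator_at:
  assumes "is_bop S" "is_bop T" "u \<in> l2"
  shows "semi_commutator S T n u t = proj (Y n) (S (T (proj (Y n) u))) t - proj (Y n) (S (proj (Y n) (T (proj (Y n) u)))) t"
  using assms by (simp add: semi_commutator_def proj_Compl bop_l2 bop_diff l2_diff)

lemma FY_semi_commutator:
  assumes "is_bop S" "is_bop T"
  shows "semi_commutator S T \<in> FY Y"
proof (rule FYI[where c="1 * opnorm S * 1 * opnorm T * 1"])
  show "opnorm (semi_commutator S T n) \<le> 1 * opnorm S * 1 * opnorm T * 1" for n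
    unfolding semi_commutator_def
    by (intro opnorm_comp_le bop_comp opnorm_proj_le bop_proj assms order_refl)
qed (use assms in \<open>auto simp: bop_semi_commutator\<close>, auto simp: semi_commutator_def)

lemma semi_commutator_add:
  assumes "is_bop S" "is_bop T" "is_bop T'"
  shows "semi_commutator S (op_add T T') = seq_add (semi_commutator S T) (semi_commutator S T')"
proof
  fix n
  have "proj (Y n) (S (proj (- Y n) (\<lambda>t. T (proj (Y n) u) t + T' (proj (Y n) u) t))) =
    (\<lambda>t. proj (Y n) (S (proj (- Y n) (T (proj (Y n) u)))) t + proj (Y n) (S (proj (- Y n) (T' (proj (Y n) u)))) t)" for u
    using assms by (simp add: bop_add bop_l2)
  then show "semi_commutator S (op_add T T') n = seq_add (semi_commutator S T) (semi_commutator S T') n"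
    by (simp add: semi_commutator_def seq_add_def op_add_def fun_eq_iff)
qed

lemma semi_commutator_smul:
  assumes "is_bop S" "is_bop T"
  shows "semi_commutator S (op_smul c T) = seq_smul c (semi_commutator S T)"
proof
  fix n
  have "proj (Y n) (S (proj (- Y n) (\<lambda>t. c * T (proj (Y n) u) t))) =
    (\<lambda>t. c * proj (Y n) (S (proj (- Y n) (T (proj (Y n) u)))) t)" for u
    using assms by (simp add: bop_smul bop_l2)
  then show "semi_commutator S (op_smul c T) n = seq_smul c (semi_commutator S T) n"
    by (simp add: semi_commutator_def seq_smul_def op_smul_def fun_eq_iff)
qed

text \<open>Writing c(S,T) for P S T P - P S P T P, the claim c(S,TT') = c(S,T) P T' P + c(ST,T') -
  P S P c(T,T') holds by cancellation. Each right argument on the right-hand side is a single factor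
  of \<open>T \<circ> T'\<close>, which is what an induction on the right argument needs.\<close>

lemma semi_commutator_comp:
  assumes "is_bop S" "is_bop T" "is_bop T'"
  shows "semi_commutator S (T \<circ> T') = seq_add (seq_mul (semi_commutator S T) (compression Y T'))
    (seq_add (semi_commutator (S \<circ> T) T') (seq_smul (-1) (seq_mul (compression Y S) (semi_commutator T T'))))"
    (is "?L = ?R")
proof
  fix n
  show "?L n = ?R n"
  proof (rule bop_eqI)
    fix u :: "'g vec" and t assume u: "u \<in> l2"
    have "semi_commutator T T' n u = (\<lambda>t. proj (Y n) (T (T' (proj (Y n) u))) t - proj (Y n) (T (proj (Y n) (T' (proj (Y n) u)))) t)"
      by (intro ext semi_commutator_at assms u)
    then show "?L n u t = ?R n u t"
      using assms u
      by (simp add: semi_commutator_at bop_comp seq_add_def op_add_def seq_smul_def op_smul_def seq_mul_def bop_l2 bop_diff)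
  qed (use assms in \<open>auto simp: bop_semi_commutator seq_add_def seq_smul_def seq_mul_def intro!: bop_op_add bop_op_smul bop_comp bop_semi_commutator\<close>)
qed

text \<open>Whatever the shift carries from \<open>Y n\<close> into the complement starts at a point
  that leaves. Restricting to these points first makes the projection onto the complement
  redundant.\<close>

lemma semi_commutator_shift:
  assumes "is_bop S"
  shows "semi_commutator S (shift r) = seq_mul (compression Y (S \<circ> shift r)) (\<lambda>n. proj {s \<in> Y n. r + s \<notin> Y n})"
proof
  fix n
  have "proj (- Y n) (shift r (proj (Y n) u)) = shift r (proj (Y n) (proj {s \<in> Y n. r + s \<notin> Y n} u))" if "u \<in> l2" for u
    using that by (auto simp: fun_eq_iff proj_at shift_at bop_l2 add.assoc[symmetric])
  then have "semi_commutator S (shift r) n u = seq_mul (compression Y (S \<circ> shift r)) (\<lambda>n. proj {s \<in> Y n. r + s \<notin> Y n}) n u"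
    if "u \<in> l2" for u
    using that by (simp add: semi_commutator_def seq_mul_def)
  then show "semi_commutator S (shift r) n = seq_mul (compression Y (S \<circ> shift r)) (\<lambda>n. proj {s \<in> Y n. r + s \<notin> Y n}) n"
    using assms by (intro bop_eqI) (auto simp: bop_semi_commutator seq_mul_def intro!: bop_comp)
qed

text \<open>Multiplication preserves supports, so nothing passes through the complement. The zero
  sequence is written as a multiple of the generator to make its membership in the ideal
  immediate.\<close>

lemma semi_commutator_mult_op:
  assumes "is_bop S" "bdd_above (range (\<lambda>t. cmod (a t)))"
  shows "semi_commutator S (mult_op a) = seq_smul 0 bdry_seq"
proof
  fix n
  have "proj (- Y n) (mult_op a (proj (Y n) u)) = (\<lambda>t. 0)" if "u \<in> l2" for u
    using that bop_mult_op[OF assms(2)] by (auto simp: fun_eq_iff proj_at mult_op_at bop_l2)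
  then have "semi_commutator S (mult_op a) n u = (\<lambda>t. 0)" if "u \<in> l2" for u
    using that assms(1) by (simp add: semi_commutator_def bop_zero)
  then show "semi_commutator S (mult_op a) n = seq_smul 0 bdry_seq n"
    using assms bop_mult_op[OF assms(2)]
    by (intro bop_eqI) (auto simp: bop_semi_commutator seq_smul_def bop_op_smul, simp add: op_smul_def)
qed

lemma semi_commutator_within:
  assumes "is_bop S" "is_bop T" "is_bop T'" "op_within e T T'" "0 \<le> e"
  shows "op_within (opnorm S * e) (semi_commutator S T n) (semi_commutator S T' n)"
proof -
  let ?P = "proj (Y n) \<circ> S \<circ> proj (- Y n)"
  have "op_within (opnorm S * e * 1) (?P \<circ> T \<circ> proj (Y n)) (?P \<circ> T' \<circ> proj (Y n))"
    by (intro op_within_comp_right op_within_comp_left bop_comp bop_proj assms opnorm_proj_le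
        opnorm_compress_le mult_nonneg_nonneg opnorm_nonneg)
  then show ?thesis by (simp add: semi_commutator_def)
qed

lemma semi_commutator_bdry_ideal:
  assumes "T \<in> BDO" "S \<in> BDO"
  shows "semi_commutator S T \<in> bdry_ideal"
  using assms
\<comment> \<open>The left factor stays free because the product case calls for the hypothesis with
  \<open>S \<circ> A\<close> in its place.\<close>
proof (induction arbitrary: S rule: BDO_induct)
  case (shift r)
  then show ?case
    by (simp only: semi_commutator_shift BDO_bop)
      (intro bdry_ideal_mul_left bdry_ideal_proj_leave SY_compression BDO_comp BDO_shift)
next
  case (mult a)
  then show ?case
    by (simp only: semi_commutator_mult_op BDO_bop) (intro bdry_ideal_smul bdry_ideal_gen)
next
  case (add A B)
  then show ?case by (simp add: semi_commutator_add BDO_bop bdry_ideal_add)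
next
  case (comp A B)
  show ?case
    unfolding semi_commutator_comp[OF BDO_bop[OF comp(5)] BDO_bop[OF comp(1)] BDO_bop[OF comp(2)]]
    by (intro bdry_ideal_add bdry_ideal_smul bdry_ideal_mul_left bdry_ideal_mul_right comp SY_compression BDO_comp)
next
  case (smul c A)
  then show ?case by (simp add: semi_commutator_smul BDO_bop bdry_ideal_smul)
next
  case (limit L)
  note S = BDO_bop[OF limit(3)] and L = BDO_bop[OF limit(1)]
  show ?case
  proof (rule bdry_ideal_limit[OF FY_semi_commutator[OF S L]])
    fix e :: real assume e: "0 < e"
    define d where "d = e / (opnorm S + 1)"
    have pos: "0 < opnorm S + 1" using opnorm_nonneg[OF S] by linarith
    have d: "0 < d" "opnorm S * d \<le> e" using e pos by (auto simp: d_def field_simps)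
    obtain X where X: "X \<in> BDO" "semi_commutator S X \<in> bdry_ideal" "op_within d X L"
      using limit(2)[OF d(1)] limit(3) by blast
    have "op_within e (semi_commutator S X n) (semi_commutator S L n)" for n
      using semi_commutator_within[OF S BDO_bop[OF X(1)] L X(3)] d op_within_mono by fastforce
    then show "\<exists>X\<in>bdry_ideal. \<forall>n. op_within e (X n) (semi_commutator S L n)" using X(2) by blast
  qed
qed

text \<open>\<open>closed_ideal_gen\<close> does not mention adjoints; but the generator is
  self-adjoint, and taking adjoints exchanges left and right multiplication.\<close>

lemma bdry_ideal_adj: "A \<in> bdry_ideal \<Longrightarrow> seq_adj A \<in> bdry_ideal"
proof (induction rule: bdry_ideal_induct)
  case (gen A)
  then show ?case using bdry_ideal_gen by (simp add: seq_adj_def op_adj_proj)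
next
  case (add A B)
  then show ?case by (simp add: seq_adj_add[OF bdry_ideal_FY bdry_ideal_FY] bdry_ideal_add)
next
  case (smul c A)
  then show ?case by (simp add: seq_adj_smul[OF bdry_ideal_FY] bdry_ideal_smul)
next
  case (mul_right A B)
  then show ?case
    by (simp add: seq_adj_mul[OF bdry_ideal_FY SY_FY] bdry_ideal_mul_left SY_adj)
next
  case (mul_left A B)
  then show ?case
    by (simp add: seq_adj_mul[OF SY_FY bdry_ideal_FY] bdry_ideal_mul_right SY_adj)
next
  case (limit L)
  show ?case
  proof (rule bdry_ideal_limit)
    show "seq_adj L \<in> FY Y" using limit(1) bdry_ideal_FY FY_adj by blast
    fix e :: real assume e: "0 < e"
    obtain X where X: "X \<in> bdry_ideal" "seq_adj X \<in> bdry_ideal" "\<And>n. op_within e (X n) (L n)"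
      using limit(2)[OF e] by blast
    have "op_within e (seq_adj X n) (seq_adj L n)" for n
      unfolding seq_adj_def
      using e by (intro op_within_adj X SY_bop[OF bdry_ideal_SY[OF X(1)]] SY_bop[OF bdry_ideal_SY[OF limit(1)]]) simp
    then show "\<exists>X\<in>bdry_ideal. \<forall>n. op_within e (X n) (seq_adj L n)" using X(2) by blast
  qed
qed

lemma bdry_ideal_strongly_null: "A \<in> bdry_ideal \<Longrightarrow> strongly_null A"
proof (induction rule: bdry_ideal_induct)
  case (gen A)
  then show ?case using strongly_null_bdry_seq by simp
next
  case (add A B)
  show ?case
    unfolding strongly_null_def
  proof
    fix u :: "'g vec" assume u: "u \<in> l2"
    note l2 = bop_l2[OF SY_bop[OF bdry_ideal_SY[OF add(1)]] u] bop_l2[OF SY_bop[OF bdry_ideal_SY[OF add(2)]] u]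
    have s: "(\<lambda>n. l2norm (A n u) + l2norm (B n u)) \<longlonglongrightarrow> 0"
      using tendsto_add[of "\<lambda>n. l2norm (A n u)" 0] add(3,4) u by (fastforce simp: strongly_null_def)
    show "(\<lambda>n. l2norm (seq_add A B n u)) \<longlonglongrightarrow> 0"
      by (rule tendsto_sandwich[OF _ _ tendsto_const s])
        (auto simp: seq_add_def op_add_def intro!: always_eventually l2norm_triangle l2)
  qed
next
  case (smul c A)
  then show ?case
    unfolding strongly_null_def seq_smul_def op_smul_def l2norm_smul
    by (auto intro: tendsto_mult_right_zero)
next
  case (mul_right A B)
  show ?case
  proof (rule strongly_nullI)
    fix u :: "'g vec" and e :: real assume u: "u \<in> l2" and e: "0 < e"
    note A = bdry_ideal_FY[OF mul_right(1)]
    obtain c where c: "0 < c" "\<And>n. opnorm (A n) \<le> c" using FY_bounded[OF A] by metis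
    note l2 = bop_l2[OF SY_bop[OF mul_right(2)] u] bop_l2[OF FY_bop[OF A]]
    \<comment> \<open>The vector \<open>B n u\<close> moves with \<open>n\<close>. Strong
      convergence of \<open>B\<close> allows it to be replaced by the fixed \<open>B N u\<close>, at
      which \<open>A\<close> tends to 0.\<close>
    obtain N where N: "\<And>m n. m \<ge> N \<Longrightarrow> n \<ge> N \<Longrightarrow> l2norm (\<lambda>t. B m u t - B n u t) \<le> e / (2 * c)"
      using strongly_cauchyD[OF SY_strongly_cauchy[OF mul_right(2)] u, of "e / (2 * c)"] e c(1) by auto
    obtain M where M: "\<And>n. n \<ge> M \<Longrightarrow> l2norm (A n (B N u)) < e / 2"
      using strongly_nullD[OF mul_right(3) l2(1), of "e / 2" N] e by auto
    show "\<exists>N. \<forall>n\<ge>N. l2norm (seq_mul A B n u) \<le> e"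
    proof (intro exI allI impI)
      fix n assume n: "n \<ge> max M N"
      have "l2norm (A n (B n u)) \<le> l2norm (A n (B N u)) + l2norm (\<lambda>t. A n (B n u) t - A n (B N u) t)"
        by (intro l2norm_diff_bound l2)
      moreover have "l2norm (\<lambda>t. A n (B n u) t - A n (B N u) t) \<le> c * l2norm (\<lambda>t. B n u t - B N u t)"
        by (intro bounded_apply_diff FY_bop[OF A] c l2)
      moreover have "c * l2norm (\<lambda>t. B n u t - B N u t) \<le> c * (e / (2 * c))"
        using c(1) n by (intro mult_left_mono N) auto
      moreover have "c * (e / (2 * c)) = e / 2" using c(1) by simp
      ultimately have "l2norm (A n (B n u)) \<le> e" using M[of n] n by simp
      then show "l2norm (seq_mul A B n u) \<le> e" by (simp add: seq_mul_def)
    qed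
  qed
next
  case (mul_left A B)
  show ?case
    unfolding strongly_null_def
  proof
    fix u :: "'g vec" assume u: "u \<in> l2"
    note B = SY_FY[OF mul_left(2)]
    obtain c where c: "0 < c" "\<And>n. opnorm (B n) \<le> c" using FY_bounded[OF B] by metis
    have s: "(\<lambda>n. c * l2norm (A n u)) \<longlonglongrightarrow> 0"
      using mul_left(3) u by (auto simp: strongly_null_def intro: tendsto_mult_right_zero)
    have "l2norm (seq_mul B A n u) \<le> c * l2norm (A n u)" for n
      using opnorm_le_iff[OF FY_bop[OF B], of c n] c bop_l2[OF SY_bop[OF bdry_ideal_SY[OF mul_left(1)]] u]
      by (simp add: seq_mul_def)
    then show "(\<lambda>n. l2norm (seq_mul B A n u)) \<longlonglongrightarrow> 0"
      by (intro tendsto_sandwich[OF _ _ tendsto_const s]) auto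
  qed
next
  case (limit L)
  show ?case
  proof (rule strongly_nullI)
    fix u :: "'g vec" and e :: real assume u: "u \<in> l2" and e: "0 < e"
    define d where "d = e / (2 * (l2norm u + 1))"
    have pos: "0 < l2norm u + 1" using l2norm_nonneg[of u] by linarith
    have d: "0 < d" "d * l2norm u \<le> e / 2" using e pos by (auto simp: d_def field_simps)
    obtain X where X: "X \<in> bdry_ideal" "strongly_null X" "\<And>n. op_within d (X n) (L n)"
      using limit(2)[OF d(1)] by blast
    obtain N where N: "\<And>n. n \<ge> N \<Longrightarrow> l2norm (X n u) < e / 2"
      using strongly_nullD[OF X(2) u, of "e / 2"] e by auto
    note l2 = bop_l2[OF SY_bop[OF bdry_ideal_SY[OF limit(1)]] u] bop_l2[OF SY_bop[OF bdry_ideal_SY[OF X(1)]] u]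
    show "\<exists>N. \<forall>n\<ge>N. l2norm (L n u) \<le> e"
    proof (intro exI allI impI)
      fix n assume n: "n \<ge> N"
      have "l2norm (L n u) \<le> l2norm (X n u) + l2norm (\<lambda>t. L n u t - X n u t)"
        by (intro l2norm_diff_bound l2)
      moreover have "l2norm (\<lambda>t. L n u t - X n u t) \<le> d * l2norm u"
        using X(3)[of n] u by (subst l2norm_minus_commute) (simp add: op_within_def)
      ultimately show "l2norm (L n u) \<le> e" using N[OF n] d(2) by linarith
    qed
  qed
qed

section \<open>The dense subalgebra of compressions plus ideal elements, and the identification of
  \<open>JY Y\<close>\<close>

definition compression_plus_ideal :: "'g opseq set" where
  "compression_plus_ideal = {seq_add (compression Y T) J | T J. T \<in> BDO \<and> J \<in> bdry_ideal}"

lemma compression_plus_ideal_SY: "X \<in> compression_plus_ideal \<Longrightarrow> X \<in> SY Y"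
  by (auto simp: compression_plus_ideal_def intro!: SY_add SY_compression elim: bdry_ideal_SY)

lemma compression_plus_idealI:
  "T \<in> BDO \<Longrightarrow> J \<in> bdry_ideal \<Longrightarrow> X = seq_add (compression Y T) J \<Longrightarrow> X \<in> compression_plus_ideal"
  by (auto simp: compression_plus_ideal_def)

lemma compression_plus_ideal_add:
  assumes "X \<in> compression_plus_ideal" "X' \<in> compression_plus_ideal"
  shows "seq_add X X' \<in> compression_plus_ideal"
proof -
  obtain T J T' J' where X: "T \<in> BDO" "J \<in> bdry_ideal" "X = seq_add (compression Y T) J"
    and X': "T' \<in> BDO" "J' \<in> bdry_ideal" "X' = seq_add (compression Y T') J'"
    using assms by (auto simp: compression_plus_ideal_def)
  show ?thesis
    by (rule compression_plus_idealI[OF BDO_add[OF X(1) X'(1)] bdry_ideal_add[OF X(2) X'(2)]])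
      (auto simp: X(3) X'(3) seq_add_def op_add_def fun_eq_iff bop_add bop_l2 BDO_bop X(1) X'(1))
qed

lemma compression_plus_ideal_smul:
  assumes "X \<in> compression_plus_ideal"
  shows "seq_smul c X \<in> compression_plus_ideal"
proof -
  obtain T J where X: "T \<in> BDO" "J \<in> bdry_ideal" "X = seq_add (compression Y T) J"
    using assms by (auto simp: compression_plus_ideal_def)
  show ?thesis
    by (rule compression_plus_idealI[OF BDO_smul[OF X(1)] bdry_ideal_smul[OF X(2)]])
      (auto simp: X(3) seq_add_def op_add_def seq_smul_def op_smul_def fun_eq_iff bop_smul bop_l2 BDO_bop X(1) algebra_simps)
qed

lemma compression_plus_ideal_adj:
  assumes "X \<in> compression_plus_ideal"
  shows "seq_adj X \<in> compression_plus_ideal"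
proof -
  obtain T J where X: "T \<in> BDO" "J \<in> bdry_ideal" "X = seq_add (compression Y T) J"
    using assms by (auto simp: compression_plus_ideal_def)
  have "seq_adj X = seq_add (compression Y (op_adj T)) (seq_adj J)"
    unfolding X(3) seq_adj_add[OF FY_compression[OF BDO_bop[OF X(1)]] bdry_ideal_FY[OF X(2)]]
      seq_adj_compression[OF BDO_bop[OF X(1)]] ..
  then show ?thesis
    by (rule compression_plus_idealI[OF BDO_adj[OF X(1)] bdry_ideal_adj[OF X(2)]])
qed

lemma compression_plus_ideal_mul:
  assumes "X \<in> compression_plus_ideal" "X' \<in> compression_plus_ideal"
  shows "seq_mul X X' \<in> compression_plus_ideal"
proof -
  obtain T J T' J' where X: "T \<in> BDO" "J \<in> bdry_ideal" "X = seq_add (compression Y T) J"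
    and X': "T' \<in> BDO" "J' \<in> bdry_ideal" "X' = seq_add (compression Y T') J'"
    using assms by (auto simp: compression_plus_ideal_def)
  note b = BDO_bop[OF X(1)] BDO_bop[OF X'(1)] SY_bop[OF bdry_ideal_SY[OF X(2)]] SY_bop[OF bdry_ideal_SY[OF X'(2)]]
  \<comment> \<open>The ideal part of the expanded product: the product of the compressions is the
    compression of \<open>T \<circ> T'\<close> minus the semi-commutator. \<open>J\<close> meets all
    of \<open>X'\<close> but \<open>J'\<close> only the compression of \<open>T\<close>, so that the
    term with \<open>J\<close> and \<open>J'\<close> is counted once.\<close>
  define K where "K = seq_add (seq_smul (-1) (semi_commutator T T'))
    (seq_add (seq_mul (compression Y T) J') (seq_mul J X'))"
  have K: "K \<in> bdry_ideal" unfolding K_def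
    by (intro bdry_ideal_add bdry_ideal_smul bdry_ideal_mul_left bdry_ideal_mul_right
        semi_commutator_bdry_ideal SY_compression X X' compression_plus_ideal_SY assms)
  have "seq_mul X X' n = seq_add (compression Y (T \<circ> T')) K n" for n
  proof (rule bop_eqI)
    show "is_bop (seq_mul X X' n)"
      by (intro SY_bop[where Y=Y] SY_mul compression_plus_ideal_SY assms)
    show "is_bop (seq_add (compression Y (T \<circ> T')) K n)"
      by (intro SY_bop[where Y=Y] SY_add SY_compression BDO_comp X X' bdry_ideal_SY K)
    fix u :: "'g vec" and t assume u: "u \<in> l2"
    show "seq_mul X X' n u t = seq_add (compression Y (T \<circ> T')) K n u t"
      using u b by (simp add: K_def X(3) X'(3) seq_add_def op_add_def seq_smul_def op_smul_def
          seq_mul_def semi_commutator_at bop_add bop_l2 l2_add)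
  qed
  then show ?thesis
    by (intro compression_plus_idealI[OF BDO_comp[OF X(1) X'(1)] K]) blast
qed

text \<open>No closedness of \<open>compression_plus_ideal\<close> is claimed: the approximation
  property itself is stable under the algebra operations and under limits.\<close>

lemma SY_approx:
  assumes "A \<in> SY Y"
  shows "\<forall>e>0. \<exists>X\<in>compression_plus_ideal. \<forall>n. op_within e (X n) (A n)"
  using assms
proof (induction rule: SY_induct)
  case (compression T)
  have "seq_add (compression Y T) (seq_smul 0 bdry_seq) = compression Y T"
    by (simp add: seq_add_def op_add_def seq_smul_def op_smul_def comp_def)
  then have "compression Y T \<in> compression_plus_ideal"
    by (intro compression_plus_idealI[OF compression bdry_ideal_smul[OF bdry_ideal_gen, of 0]]) simp
  then show ?case by (meson op_within_refl less_imp_le)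
next
  case (add A B)
  show ?case
  proof (intro allI impI)
    fix e :: real assume "0 < e"
    then have e: "0 < e / 2" by simp
    obtain X where X: "X \<in> compression_plus_ideal" "\<And>n. op_within (e / 2) (X n) (A n)" using add(3) e by blast
    obtain X' where X': "X' \<in> compression_plus_ideal" "\<And>n. op_within (e / 2) (X' n) (B n)" using add(4) e by blast
    have "op_within (e / 2 + e / 2) (seq_add X X' n) (seq_add A B n)" for n
      unfolding seq_add_def
      by (intro op_within_add X X' SY_bop[OF compression_plus_ideal_SY[OF X(1)]]
          SY_bop[OF compression_plus_ideal_SY[OF X'(1)]] SY_bop[OF add(1)] SY_bop[OF add(2)])
    then show "\<exists>X\<in>compression_plus_ideal. \<forall>n. op_within e (X n) (seq_add A B n)"
      using compression_plus_ideal_add[OF X(1) X'(1)] by auto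
  qed
next
  case (mul A B)
  show ?case
  proof (intro allI impI)
    fix e :: real assume e: "0 < e"
    obtain c where c: "0 < c" "\<And>n. opnorm (A n) \<le> c" using FY_bounded[OF SY_FY[OF mul(1)]] by metis
    define d where "d = e / (2 * c)"
    have d: "0 < d" "c * d = e / 2" using e c(1) by (auto simp: d_def)
    \<comment> \<open>\<open>X'\<close> is fixed before \<open>X\<close>, since the tolerance for
      \<open>X\<close> depends on the bound \<open>c'\<close> of \<open>X'\<close>. The intermediate
      product is \<open>A n \<circ> X' n\<close>, and each half of the error costs
      \<open>e / 2\<close>.\<close>
    obtain X' where X': "X' \<in> compression_plus_ideal" "\<And>n. op_within d (X' n) (B n)" using mul(4) d by blast
    note bX' = SY_bop[OF compression_plus_ideal_SY[OF X'(1)]]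
    obtain c' where c': "0 < c'" "\<And>n. opnorm (X' n) \<le> c'"
      using FY_bounded[OF SY_FY[OF compression_plus_ideal_SY[OF X'(1)]]] by metis
    define d' where "d' = e / (2 * c')"
    have d': "0 < d'" "d' * c' = e / 2" using e c'(1) by (auto simp: d'_def)
    obtain X where X: "X \<in> compression_plus_ideal" "\<And>n. op_within d' (X n) (A n)" using mul(3) d' by blast
    note bX = SY_bop[OF compression_plus_ideal_SY[OF X(1)]]
    have "op_within (d' * c' + c * d) (X n \<circ> X' n) (A n \<circ> B n)" for n
    proof (rule op_within_trans)
      show "op_within (d' * c') (X n \<circ> X' n) (A n \<circ> X' n)"
        using d' by (intro op_within_comp_right X c' bX') simp
      show "op_within (c * d) (A n \<circ> X' n) (A n \<circ> B n)"
        using d by (intro op_within_comp_left X' c bX' SY_bop[OF mul(1)] SY_bop[OF mul(2)]) simp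
    qed (intro bop_comp bX bX' SY_bop[OF mul(1)] SY_bop[OF mul(2)])+
    then have "op_within e (seq_mul X X' n) (seq_mul A B n)" for n
      by (simp add: seq_mul_def d(2) d'(2))
    then show "\<exists>X\<in>compression_plus_ideal. \<forall>n. op_within e (X n) (seq_mul A B n)"
      using compression_plus_ideal_mul[OF X(1) X'(1)] by auto
  qed
next
  case (smul c A)
  show ?case
  proof (intro allI impI)
    fix e :: real assume e: "0 < e"
    define d where "d = e / (cmod c + 1)"
    have pos: "0 < cmod c + 1" by (simp add: add_nonneg_pos)
    have d: "0 < d" "cmod c * d \<le> e" using e pos by (auto simp: d_def field_simps)
    obtain X where X: "X \<in> compression_plus_ideal" "\<And>n. op_within d (X n) (A n)" using smul(2) d by blast
    have "op_within e (seq_smul c X n) (seq_smul c A n)" for n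
      unfolding seq_smul_def by (rule op_within_mono[OF op_within_smul[OF X(2)] d(2)])
    then show "\<exists>X\<in>compression_plus_ideal. \<forall>n. op_within e (X n) (seq_smul c A n)"
      using compression_plus_ideal_smul[OF X(1)] by auto
  qed
next
  case (adj A)
  show ?case
  proof (intro allI impI)
    fix e :: real assume e: "0 < e"
    obtain X where X: "X \<in> compression_plus_ideal" "\<And>n. op_within e (X n) (A n)" using adj(2) e by blast
    have "op_within e (seq_adj X n) (seq_adj A n)" for n
      unfolding seq_adj_def using e
      by (intro op_within_adj X SY_bop[OF compression_plus_ideal_SY[OF X(1)]] SY_bop[OF adj(1)]) simp
    then show "\<exists>X\<in>compression_plus_ideal. \<forall>n. op_within e (X n) (seq_adj A n)"
      using compression_plus_ideal_adj[OF X(1)] by auto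
  qed
next
  case (limit L)
  show ?case
  proof (intro allI impI)
    fix e :: real assume "0 < e"
    then have e: "0 < e / 2" by simp
    obtain Z where Z: "Z \<in> SY Y" "\<And>n. op_within (e / 2) (Z n) (L n)"
      and Z': "\<forall>e>0. \<exists>X\<in>compression_plus_ideal. \<forall>n. op_within e (X n) (Z n)"
      using limit(2)[OF e] by blast
    obtain X where X: "X \<in> compression_plus_ideal" "\<And>n. op_within (e / 2) (X n) (Z n)" using Z' e by blast
    have "op_within (e / 2 + e / 2) (X n) (L n)" for n
      by (intro op_within_trans[OF _ _ _ X(2) Z(2)] SY_bop[OF compression_plus_ideal_SY[OF X(1)]]
          SY_bop[OF Z(1)] SY_bop[OF limit(1)])
    then show "\<exists>X\<in>compression_plus_ideal. \<forall>n. op_within e (X n) (L n)" using X(1) by auto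
  qed
qed

lemma JY_iff: "A \<in> JY Y \<longleftrightarrow> A \<in> SY Y \<and> strongly_null A"
  by (auto simp: JY_def strongly_null_def SY_FY)

text \<open>If \<open>P T P + J\<close> is close to a strongly null sequence, then its strong limit \<open>T\<close> is small in norm.\<close>

lemma strongly_null_bdry_ideal:
  assumes A: "A \<in> SY Y" "strongly_null A"
  shows "A \<in> bdry_ideal"
proof (rule bdry_ideal_limit[OF SY_FY[OF A(1)]])
  fix e :: real assume "0 < e"
  then have e: "0 < e / 2" by simp
  obtain X where X: "X \<in> compression_plus_ideal" "\<And>n. op_within (e / 2) (X n) (A n)"
    using SY_approx[OF A(1)] e by blast
  then obtain T J where T: "T \<in> BDO" and J: "J \<in> bdry_ideal" and X_eq: "X = seq_add (compression Y T) J"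
    by (auto simp: compression_plus_ideal_def)
  note bT = BDO_bop[OF T] and bJ = SY_bop[OF bdry_ideal_SY[OF J]] and bA = SY_bop[OF A(1)]
  have XA: "l2norm (\<lambda>t. compression Y T n u t + J n u t - A n u t) \<le> e / 2 * l2norm u" if "u \<in> l2" for u n
    using X(2)[of n] that by (simp add: op_within_def X_eq seq_add_def op_add_def)
  have T_small: "l2norm (T u) \<le> e / 2 * l2norm u" if u: "u \<in> l2" for u
  proof (rule tendsto_lowerbound)
    \<comment> \<open>Triangle inequality from \<open>T u\<close> to its compression and from there
      to \<open>A n u - J n u\<close>; all terms after the first tend to 0.\<close>
    let ?b = "\<lambda>n. e / 2 * l2norm u + l2norm (\<lambda>t. compression Y T n u t - T u t) + l2norm (J n u) + l2norm (A n u)"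
    show "?b \<longlonglongrightarrow> e / 2 * l2norm u"
      using tendsto_add[OF tendsto_add[OF tendsto_add[OF tendsto_const compression_tendsto[OF bT u]]]]
        bdry_ideal_strongly_null[OF J] A(2) u unfolding strongly_null_def by fastforce
    show "\<forall>\<^sub>F n in sequentially. l2norm (T u) \<le> ?b n"
    proof (rule always_eventually, rule allI)
      fix n
      note l2 = bop_l2[OF bT u] bop_l2[OF bJ u, of n] bop_l2[OF bA u, of n]
      have c: "compression Y T n u \<in> l2" by simp
      let ?d = "\<lambda>t. compression Y T n u t + J n u t - A n u t"
      have d: "?d \<in> l2" by (intro l2_diff l2_add c l2)
      have "l2norm (compression Y T n u) \<le> l2norm ?d + l2norm (\<lambda>t. A n u t - J n u t)"
        using l2norm_triangle[OF d l2_diff[OF l2(3,2)]] by simp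
      moreover have "l2norm (\<lambda>t. A n u t - J n u t) \<le> l2norm (A n u) + l2norm (J n u)"
        by (rule l2norm_triangle_diff[OF l2(3,2)])
      moreover have "l2norm (T u) \<le> l2norm (compression Y T n u) + l2norm (\<lambda>t. T u t - compression Y T n u t)"
        by (rule l2norm_diff_bound[OF l2(1) c])
      ultimately show "l2norm (T u) \<le> ?b n"
        using XA[OF u, of n] l2norm_minus_commute[of "T u" "compression Y T n u"] by linarith
    qed
  qed simp
  \<comment> \<open>J - A = (P T P + J - A) - P T P. The first part is within \<open>e / 2\<close>
    by the choice of \<open>X\<close>, the second because a compression of \<open>T\<close> inherits
    the bound \<open>T_small\<close>.\<close>
  have "op_within e (J n) (A n)" for n
    unfolding op_within_def
  proof
    fix u :: "'g vec" assume u: "u \<in> l2"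
    note l2 = bop_l2[OF bJ u, of n] bop_l2[OF bA u, of n]
    have c: "compression Y T n u \<in> l2" by simp
    let ?d = "\<lambda>t. compression Y T n u t + J n u t - A n u t"
    have d: "?d \<in> l2" by (intro l2_diff l2_add c l2)
    have "l2norm (\<lambda>t. J n u t - A n u t) \<le> l2norm ?d + l2norm (compression Y T n u)"
      using l2norm_triangle_diff[OF d c] by (simp add: algebra_simps)
    moreover have "l2norm (compression Y T n u) \<le> l2norm (T (proj (Y n) u))"
      using l2norm_proj_le[OF bop_l2[OF bT proj_l2]] by simp
    moreover have "l2norm (T (proj (Y n) u)) \<le> e / 2 * l2norm (proj (Y n) u)"
      by (rule T_small) simp
    moreover have "e / 2 * l2norm (proj (Y n) u) \<le> e / 2 * l2norm u"
      using e by (intro mult_left_mono l2norm_proj_le u) auto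
    ultimately have "l2norm (\<lambda>t. J n u t - A n u t) \<le> e / 2 * l2norm u + e / 2 * l2norm u"
      using XA[OF u, of n] by linarith
    then show "l2norm (\<lambda>t. J n u t - A n u t) \<le> e * l2norm u" by simp
  qed
  then show "\<exists>X\<in>bdry_ideal. \<forall>n. op_within e (X n) (A n)" using J by blast
qed

lemma JY_eq_bdry_ideal: "JY Y = bdry_ideal"
  using strongly_null_bdry_ideal bdry_ideal_SY bdry_ideal_strongly_null JY_iff by blast

end

theorem mainTheorem4:
  fixes \<Omega> :: "'g::{group_add, countable} set" and Y :: "nat \<Rightarrow> 'g set"
  assumes "finite \<Omega>" and "0 \<in> \<Omega>" and "sgrp_gen \<Omega> = UNIV"
    and "\<And>n. finite (Y n)" and "(\<Union>n. Y n) = UNIV"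
    and "\<And>n. Y n \<subseteq> int_Om \<Omega> (Y (Suc n))"
  shows "(\<lambda>n. proj (bdry_Om \<Omega> (Y n))) \<in> SY Y
    \<and> JY Y = closed_ideal_gen Y (SY Y) {(\<lambda>n. proj (bdry_Om \<Omega> (Y n)))}"
proof -
  interpret exhaustion \<Omega> Y by unfold_locales (fact assms)+
  show ?thesis using SY_bdry_seq JY_eq_bdry_ideal by blast
qed

end
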